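(* If $\mathfrak{s}_{\omega,\omega} \leq \mathfrak{b}$, then there is a weakly tight family $\mathscr{A} \subset [\omega]^{\omega}$ of size $\mathfrak{c}$. In particular, weakly tight families of size $\mathfrak{c}$ exist if $\mathfrak{b} = \mathfrak{d}$, or if $\mathfrak{s}_{\omega,\omega} = \omega_1$.
   Context: We work in ZFC. $[\omega]^{\omega}$ is the set of infinite subsets of $\omega$, $\mathfrak{c}=2^{\aleph_0}$, $\bar e = \omega\setminus e$ for $e \subset \omega$, and $\exists^{\infty} n$ means "for infinitely many $n\in\omega$". $\mathfrak{b}$ and $\mathfrak{d}$ are the usual bounding and dominating numbers: the least size of an unbounded, respectively dominating, family in $\omega^{\omega}$ under eventual domination. $\mathfrak{s}_{\omega,\omega}$ is the least cardinal $\kappa$ such that there is a family $\{e_\alpha : \alpha<\kappa\}\subset[\omega]^{\omega}$ such that for any collection $\{b_n : n\in\omega\}\subset[\omega]^{\omega}$ there exists $\alpha<\kappa$ with $\exists^{\infty} n\in\omega\,(|b_n\cap e_\alpha|=\omega)$ and $\exists^{\infty} n\in\omega\,(|b_n\cap \bar e_\alpha|=\omega)$. A family $\mathscr{A}\subset[\omega]^{\omega}$ is almost disjoint (a.d.) if any two distinct members have finite intersection. $\mathcal{I}(\mathscr{A})$ is the ideal on $\omega$ generated by $\mathscr{A}$ (ideals on $\omega$ contain all finite sets, so $x\in\mathcal{I}(\mathscr{A})$ iff $x\setminus\bigcup\mathcal{F}$ is finite for some finite $\mathcal{F}\subset\mathscr{A}$), and $\mathcal{I}^{+}(\mathscr{A})=\mathcal{P}(\omega)\setminus\mathcal{I}(\mathscr{A})$.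 An a.d. family $\mathscr{A}\subset[\omega]^{\omega}$ is weakly tight if for every countable collection $\{b_n : n\in\omega\}\subset\mathcal{I}^{+}(\mathscr{A})$ there is $a\in\mathscr{A}$ such that $\exists^{\infty} n\in\omega\,(|b_n\cap a|=\omega)$. *)

theory Defs
  imports Main "HOL.Hull" "HOL-Library.Infinite_Set" "HOL-Library.Nat_Bijection"
begin

unbundle cardinal_syntax

section \<open>Cardinal invariants\<close>

text \<open>
  Cardinals are the cardinal orders of the library, so a cardinal is determined only up to
  \<open>=o\<close>, and all comparisons are made with \<open>\<le>o\<close> and \<open>=o\<close>. The following is the least
  cardinality of a member of \<open>\<F>\<close>; the choice is between \<open>=o\<close>-equivalent
  representatives only, and it is meaningful whenever \<open>\<F>\<close> is nonempty.
\<close>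

definition min_card :: "'a set set \<Rightarrow> 'a rel" where
  "min_card \<F> = (SOME r. r \<in> card_of ` \<F> \<and> (\<forall>r' \<in> card_of ` \<F>. r \<le>o r'))"

lemma min_card:
  assumes "\<F> \<noteq> {}"
  shows min_card_attained: "\<exists>F\<in>\<F>. min_card \<F> = |F|"
    and min_card_le: "F \<in> \<F> \<Longrightarrow> min_card \<F> \<le>o |F|"
proof -
  have "\<exists>r. r \<in> card_of ` \<F> \<and> (\<forall>r' \<in> card_of ` \<F>. r \<le>o r')"
    using exists_minim_Card_order[of "card_of ` \<F>"] assms card_of_Card_order by blast
  from someI_ex[OF this]
  have *: "min_card \<F> \<in> card_of ` \<F> \<and> (\<forall>r' \<in> card_of ` \<F>. min_card \<F> \<le>o r')"
    unfolding min_card_def .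
  show "\<exists>F\<in>\<F>. min_card \<F> = |F|" using * by auto
  show "F \<in> \<F> \<Longrightarrow> min_card \<F> \<le>o |F|" using * by auto
qed

definition eventually_dominated :: "(nat \<Rightarrow> nat) \<Rightarrow> (nat \<Rightarrow> nat) \<Rightarrow> bool" (infix \<open>\<le>*\<close> 50) where
  "f \<le>* g \<longleftrightarrow> (\<forall>\<^sub>\<infinity>n. f n \<le> g n)"

definition unbounded_family :: "(nat \<Rightarrow> nat) set \<Rightarrow> bool" where
  "unbounded_family F \<longleftrightarrow> \<not> (\<exists>g. \<forall>f\<in>F. f \<le>* g)"

definition dominating_family :: "(nat \<Rightarrow> nat) set \<Rightarrow> bool" where
  "dominating_family F \<longleftrightarrow> (\<forall>g. \<exists>f\<in>F. g \<le>* f)"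

definition bounding_number :: "(nat \<Rightarrow> nat) rel" (\<open>\<bb>\<close>) where
  "\<bb> = min_card {F. unbounded_family F}"

definition dominating_number :: "(nat \<Rightarrow> nat) rel" (\<open>\<dd>\<close>) where
  "\<dd> = min_card {F. dominating_family F}"

definition omega_omega_splitting :: "nat set set \<Rightarrow> bool" where
  "omega_omega_splitting E \<longleftrightarrow>
     (\<forall>e\<in>E. infinite e) \<and>
     (\<forall>b :: nat \<Rightarrow> nat set. (\<forall>n. infinite (b n)) \<longrightarrow>
        (\<exists>e\<in>E. (\<exists>\<^sub>\<infinity>n. infinite (b n \<inter> e)) \<and> (\<exists>\<^sub>\<infinity>n. infinite (b n \<inter> - e))))"

definition s_omega_omega :: "nat set rel" (\<open>\<ss>\<^bsub>\<omega>,\<omega>\<^esub>\<close>) where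
  "\<ss>\<^bsub>\<omega>,\<omega>\<^esub> = min_card {E. omega_omega_splitting E}"

abbreviation continuum :: "(nat \<Rightarrow> bool) rel" (\<open>\<cc>\<close>) where
  "\<cc> \<equiv> ctwo ^c natLeq"

abbreviation omega_1 :: "nat set rel" (\<open>\<omega>\<^sub>1\<close>) where
  "\<omega>\<^sub>1 \<equiv> cardSuc natLeq"

text \<open>The three minima are taken over nonempty collections.\<close>

lemma unbounded_family_UNIV: "unbounded_family UNIV"
proof -
  have "\<not> (\<lambda>n. Suc (g n)) \<le>* g" for g
    by (simp add: eventually_dominated_def not_le)
  then show ?thesis unfolding unbounded_family_def by blast
qed

lemma dominating_family_UNIV: "dominating_family UNIV"
  unfolding dominating_family_def eventually_dominated_def by (metis MOST_I UNIV_I order_refl)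

lemma omega_omega_splitting_Collect_infinite: "omega_omega_splitting {e. infinite e}"
  unfolding omega_omega_splitting_def
proof (intro conjI allI impI)
  fix b :: "nat \<Rightarrow> nat set"
  assume b: "\<forall>n. infinite (b n)"
  define i where "i k = fst (prod_decode k)" for k
  define P where "P k = (even (snd (prod_decode k)))" for k
  have "\<exists>x. \<forall>k. x k \<in> b (i k) \<and> x k < x (Suc k)"
  proof (rule dependent_nat_choice)
    show "\<exists>x. x \<in> b (i 0)" using b by (metis finite.emptyI equals0I)
    show "\<exists>y. y \<in> b (i (Suc n)) \<and> x < y" for x n
      using b unfolding infinite_nat_iff_unbounded by blast
  qed
  then obtain x where x: "x k \<in> b (i k)" "x k < x (Suc k)" for k by blast
  then have inj: "inj x" by (simp add: strict_mono_Suc_iff strict_mono_imp_inj_on)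
  let ?e = "x ` {k. P k}"
  have *: "infinite (b n \<inter> x ` {k. P k \<longleftrightarrow> c})" for n c
  proof -
    let ?h = "\<lambda>m. x (prod_encode (n, if c then 2 * m else Suc (2 * m)))"
    have "inj ?h"
      by (cases c) (simp_all add: inj_def inj_eq[OF inj] prod_encode_eq)
    moreover have "range ?h \<subseteq> b n \<inter> x ` {k. P k \<longleftrightarrow> c}"
      using x(1)[of "prod_encode (n, _)"] by (auto simp: i_def P_def)
    ultimately show ?thesis using range_inj_infinite infinite_super by blast
  qed
  have e: "infinite (b n \<inter> ?e)" for n using *[of n True] by simp
  have "x ` {k. P k \<longleftrightarrow> False} \<subseteq> - ?e" using inj by (auto simp: inj_on_def)
  then have ne: "infinite (b n \<inter> - ?e)" for n
    using *[of n False] by (meson Int_mono finite_subset order_refl)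
  have "infinite ?e" using e[of 0] by blast
  then show "\<exists>e\<in>{e. infinite e}. (\<exists>\<^sub>\<infinity>n. infinite (b n \<inter> e)) \<and> (\<exists>\<^sub>\<infinity>n. infinite (b n \<inter> - e))"
    using e ne by (intro bexI[of _ ?e]) auto
qed simp

section \<open>Weakly tight families\<close>

definition almost_disjoint :: "nat set set \<Rightarrow> bool" where
  "almost_disjoint A \<longleftrightarrow> (\<forall>a\<in>A. infinite a) \<and> pairwise (\<lambda>a b. finite (a \<inter> b)) A"

text \<open>Ideals contain all finite sets and need not be proper.\<close>

definition is_ideal :: "nat set set \<Rightarrow> bool" where
  "is_ideal I \<longleftrightarrow> (\<forall>x. finite x \<longrightarrow> x \<in> I) \<and> (\<forall>x\<in>I. \<forall>y\<subseteq>x. y \<in> I) \<and> (\<forall>x\<in>I. \<forall>y\<in>I. x \<union> y \<in> I)"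

definition ideal_gen :: "nat set set \<Rightarrow> nat set set" where
  "ideal_gen A = is_ideal hull A"

definition ideal_positive :: "nat set set \<Rightarrow> nat set set" where
  "ideal_positive A = UNIV - ideal_gen A"

lemma mem_ideal_gen_iff: "x \<in> ideal_gen A \<longleftrightarrow> (\<exists>F\<subseteq>A. finite F \<and> finite (x - \<Union>F))"
proof -
  let ?J = "{x. \<exists>F\<subseteq>A. finite F \<and> finite (x - \<Union>F)}"
  have "is_ideal hull A = ?J"
  proof (rule hull_unique)
    show "A \<subseteq> ?J"
    proof
      fix a assume "a \<in> A"
      then show "a \<in> ?J" by (intro CollectI exI[of _ "{a}"]) auto
    qed
    show "is_ideal ?J"
      unfolding is_ideal_def
    proof (intro conjI allI ballI impI)
      fix x :: "nat set" assume "finite x"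
      then show "x \<in> ?J" by (intro CollectI exI[of _ "{}"]) auto
    next
      fix x y assume "x \<in> ?J" and y: "y \<subseteq> x"
      then obtain F where F: "F \<subseteq> A" "finite F" "finite (x - \<Union>F)" by blast
      have "finite (y - \<Union>F)" using y F(3) by (meson Diff_mono finite_subset order_refl)
      then show "y \<in> ?J" using F by blast
    next
      fix x y assume "x \<in> ?J" "y \<in> ?J"
      then obtain F G where "F \<subseteq> A" "finite F" "finite (x - \<Union>F)"
        and "G \<subseteq> A" "finite G" "finite (y - \<Union>G)" by blast
      moreover have "finite ((x \<union> y) - \<Union>(F \<union> G))"
        by (rule finite_subset[of _ "(x - \<Union>F) \<union> (y - \<Union>G)"]) (use calculation in auto)
      ultimately show "x \<union> y \<in> ?J"
        by (intro CollectI exI[of _ "F \<union> G"]) simp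
    qed
  next
    fix I assume I: "A \<subseteq> I" "is_ideal I"
    show "?J \<subseteq> I"
    proof
      fix x assume "x \<in> ?J"
      then obtain F where F: "F \<subseteq> A" "finite F" "finite (x - \<Union>F)" by blast
      have fin: "y \<in> I" if "finite y" for y
        using I(2) that unfolding is_ideal_def by simp
      have un: "y \<union> z \<in> I" if "y \<in> I" "z \<in> I" for y z
        using I(2) that unfolding is_ideal_def by simp
      have down: "y \<in> I" if "z \<in> I" "y \<subseteq> z" for y z
        using I(2) that unfolding is_ideal_def by simp
      have "\<Union>F \<in> I" using F(2,1)
      proof (induction F rule: finite_induct)
        case empty
        show ?case using fin[of "{}"] by simp
      next
        case (insert a F)
        then show ?case using un[of a "\<Union>F"] I(1) by auto
      qed
      then show "x \<in> I"
        using down[OF un[OF fin[OF F(3)]], of "\<Union>F" x] by blast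
    qed
  qed
  then show ?thesis unfolding ideal_gen_def by simp
qed

definition weakly_tight :: "nat set set \<Rightarrow> bool" where
  "weakly_tight A \<longleftrightarrow>
     almost_disjoint A \<and>
     (\<forall>b :: nat \<Rightarrow> nat set. range b \<subseteq> ideal_positive A \<longrightarrow>
        (\<exists>a\<in>A. \<exists>\<^sub>\<infinity>n. infinite (b n \<inter> a)))"

end

(*
  Fix a splitting family E of size s_{omega,omega} <= b, well-ordered so that proper initial
  segments have fewer than b elements. A node chooses one side of each e in an initial segment of E.
  Members of the family are built in continuum many steps; each new set is a union of pieces,
  every piece being almost contained in the sides chosen by its own node, and the tails of the
  union being almost contained in the sides chosen by one further node. A positive set (and
  likewise an infinite sequence of pieces) is split again and again by members of E; the resulting
  binary tree has continuum many branches with pairwise incompatible limit nodes, so one of them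
  is not extended by any node used before. A set guided by such a node is automatically almost
  disjoint from every earlier set all of whose nodes are incompatible with it. The nodes below the
  new one are fewer than b up to countable unions, so the remaining earlier sets can be avoided by
  dominating fewer than b functions.
*)
theory Submission
  imports Defs "HOL-Library.Countable_Set"
begin

section \<open>Small sets\<close>

text \<open>
  Every set of size less than \<open>\<bb>\<close> is small, but small sets are closed under countable
  unions for trivial reasons, so no cofinality argument about cardinals is needed.
\<close>

definition small :: "'a set \<Rightarrow> bool" where
  "small S \<longleftrightarrow> (\<forall>h :: 'a \<Rightarrow> nat \<Rightarrow> nat. \<exists>g. \<forall>s\<in>S. h s \<le>* g)"

lemma smallD: "small S \<Longrightarrow> \<exists>g. \<forall>s\<in>S. h s \<le>* g"
  unfolding small_def by blast

lemma eventually_dominated_trans: "f \<le>* g \<Longrightarrow> g \<le>* h \<Longrightarrow> f \<le>* h"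
  unfolding eventually_dominated_def
  by (rule MOST_rev_mp[of "\<lambda>n. f n \<le> g n"], assumption, rule MOST_mono, assumption) auto

lemma small_subset: "small S \<Longrightarrow> T \<subseteq> S \<Longrightarrow> small T"
  unfolding small_def by (meson subsetD)

lemma small_image: "small S \<Longrightarrow> small (f ` S)"
  unfolding small_def
proof (intro allI)
  fix h :: "'b \<Rightarrow> nat \<Rightarrow> nat"
  assume "\<forall>h. \<exists>g. \<forall>s\<in>S. h s \<le>* g"
  from this[rule_format, of "\<lambda>s. h (f s)"] show "\<exists>g. \<forall>t\<in>f ` S. h t \<le>* g" by auto
qed

text \<open>Diagonal bound: at \<open>n\<close>, add up the functions with index at most
  \<open>n\<close>; each one is then dominated from its own index on.\<close>

lemma countable_imp_small:
  assumes "countable S"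
  shows "small S"
  unfolding small_def
proof (intro allI)
  fix h :: "'a \<Rightarrow> nat \<Rightarrow> nat"
  let ?g = "\<lambda>n. \<Sum>i\<le>n. h (from_nat_into S i) n"
  have "h s \<le>* ?g" if s: "s \<in> S" for s
  proof -
    obtain i where i: "s = from_nat_into S i"
      using from_nat_into_surj[OF assms s] by metis
    have "h s n \<le> ?g n" if "i \<le> n" for n
      unfolding i using that by (intro member_le_sum) auto
    then show ?thesis
      unfolding eventually_dominated_def MOST_nat_le by blast
  qed
  then show "\<exists>g. \<forall>s\<in>S. h s \<le>* g" by blast
qed

text \<open>Smallness is applied twice: each \<open>S i\<close> yields a bound \<open>G i\<close>,
  and these bounds, indexed by the small set \<open>I\<close>, are bounded again.\<close>

lemma small_UN:
  assumes I: "small I" and S: "\<And>i. i \<in> I \<Longrightarrow> small (S i)"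
  shows "small (\<Union>i\<in>I. S i)"
  unfolding small_def
proof (intro allI)
  fix h :: "'b \<Rightarrow> nat \<Rightarrow> nat"
  have "\<forall>i\<in>I. \<exists>g. \<forall>s\<in>S i. h s \<le>* g"
    using smallD[OF S] by blast
  then obtain G where G: "\<And>i s. i \<in> I \<Longrightarrow> s \<in> S i \<Longrightarrow> h s \<le>* G i" by metis
  obtain g where "\<forall>i\<in>I. G i \<le>* g" using smallD[OF I] by blast
  then show "\<exists>g. \<forall>s\<in>(\<Union>i\<in>I. S i). h s \<le>* g"
    using G eventually_dominated_trans by (metis UN_E)
qed

lemma small_Un: "small S \<Longrightarrow> small T \<Longrightarrow> small (S \<union> T)"
  using small_UN[of "{True, False}" "\<lambda>b. if b then S else T"]
  by (simp add: countable_imp_small Un_commute)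

lemma bounding_number_attained: "\<exists>F. unbounded_family F \<and> \<bb> = |F|"
  using min_card_attained[of "{F. unbounded_family F}"] unbounded_family_UNIV
  unfolding bounding_number_def by blast

lemma small_if_less_bounding_number:
  assumes "|S| <o \<bb>"
  shows "small S"
  unfolding small_def
proof (intro allI, rule ccontr)
  fix h :: "'a \<Rightarrow> nat \<Rightarrow> nat"
  assume "\<nexists>g. \<forall>s\<in>S. h s \<le>* g"
  then have "unbounded_family (h ` S)" unfolding unbounded_family_def by simp
  then have "\<bb> \<le>o |h ` S|"
    unfolding bounding_number_def using min_card_le[of "{F. unbounded_family F}"] by blast
  then have "\<bb> \<le>o |S|" using card_of_image ordLeq_transitive by blast
  then show False using assms not_ordLess_ordLeq by blast
qed

text \<open>The form in which smallness enters the construction: thresholds depending on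
  \<open>s\<close> are replaced by one function \<open>g\<close>. Where no threshold exists the
  value of \<open>LEAST\<close> is arbitrary, but for each \<open>s\<close> this concerns only
  finitely many \<open>n\<close>.\<close>

lemma small_pred_bound:
  fixes P :: "'a \<Rightarrow> nat \<Rightarrow> nat \<Rightarrow> bool"
  assumes "small S" and "\<And>s. s \<in> S \<Longrightarrow> \<forall>\<^sub>\<infinity>n. \<exists>m. \<forall>k\<ge>m. P s n k"
  shows "\<exists>g. \<forall>s\<in>S. \<forall>\<^sub>\<infinity>n. \<forall>k\<ge>g n. P s n k"
proof -
  define h where "h s n = (LEAST m. \<forall>k\<ge>m. P s n k)" for s n
  obtain g where g: "\<forall>s\<in>S. h s \<le>* g" using smallD[OF assms(1)] by blast
  have "\<forall>\<^sub>\<infinity>n. \<forall>k\<ge>g n. P s n k" if s: "s \<in> S" for s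
  proof -
    have "\<forall>\<^sub>\<infinity>n. h s n \<le> g n" using g s unfolding eventually_dominated_def by blast
    then show ?thesis using assms(2)[OF s]
    proof eventually_elim
      case (elim n)
      from LeastI_ex[OF elim(2)] have "\<forall>k\<ge>h s n. P s n k" unfolding h_def .
      with elim(1) show ?case by auto
    qed
  qed
  then show ?thesis by blast
qed

section \<open>Sides and nodes\<close>

definition side :: "nat set \<Rightarrow> bool \<Rightarrow> nat set" where
  "side e b = (if b then e else - e)"

lemma side_simps [simp]:
  "side e (\<not> b) = - side e b" "- side e (\<not> b) = side e b"
  by (auto simp: side_def)

type_synonym node = "nat set \<Rightarrow> bool option"

text \<open>Encoding a node as a partial map on an initial segment of \<open>r\<close> makes
  extension of nodes the relation \<open>\<subseteq>\<^sub>m\<close>. Smallness of the domain stands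
  in for a length below \<bb>.\<close>

definition node :: "nat set rel \<Rightarrow> node \<Rightarrow> bool" where
  "node r \<sigma> \<longleftrightarrow> dom \<sigma> \<subseteq> Field r \<and> (\<forall>e\<in>dom \<sigma>. underS r e \<subseteq> dom \<sigma>) \<and> small (dom \<sigma>)"

definition disagree :: "node \<Rightarrow> node \<Rightarrow> bool" where
  "disagree \<sigma> \<tau> \<longleftrightarrow> (\<exists>e b. \<sigma> e = Some b \<and> \<tau> e = Some (\<not> b))"

lemma node_dom_linear:
  assumes r: "Well_order r" and "node r \<sigma>" "node r \<tau>"
  shows "dom \<sigma> \<subseteq> dom \<tau> \<or> dom \<tau> \<subseteq> dom \<sigma>"
proof (rule ccontr)
  assume "\<not> ?thesis"
  then obtain d e where d: "d \<in> dom \<sigma>" "d \<notin> dom \<tau>" and e: "e \<in> dom \<tau>" "e \<notin> dom \<sigma>" by blast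
  then have "d \<in> Field r" "e \<in> Field r" "d \<noteq> e" using assms(2,3) unfolding node_def by auto
  then have "d \<in> underS r e \<or> e \<in> underS r d"
    using r unfolding well_order_on_def linear_order_on_def total_on_def underS_def by blast
  then show False using d e assms(2,3) unfolding node_def by blast
qed

text \<open>Domains of nodes are initial segments, hence nested; if the node with the smaller domain
  is not extended by the other, the two must differ at a common element.\<close>

lemma node_disagree:
  assumes "Well_order r" and "node r \<sigma>" "node r \<tau>" and "\<not> \<sigma> \<subseteq>\<^sub>m \<tau>" "\<not> \<tau> \<subseteq>\<^sub>m \<sigma>"
  shows "disagree \<sigma> \<tau>"
proof -
  have *: "disagree \<alpha> \<beta>" if sub: "dom \<alpha> \<subseteq> dom \<beta>" and nle: "\<not> \<alpha> \<subseteq>\<^sub>m \<beta>" for \<alpha> \<beta> :: node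
  proof -
    obtain e where e: "e \<in> dom \<alpha>" "\<alpha> e \<noteq> \<beta> e" using nle unfolding map_le_def by blast
    then obtain b c where "\<alpha> e = Some b" "\<beta> e = Some c" using sub by blast
    with e(2) show ?thesis unfolding disagree_def by (intro exI[of _ e] exI[of _ b]) auto
  qed
  have sym: "disagree \<alpha> \<beta>" if "disagree \<beta> \<alpha>" for \<alpha> \<beta>
    using that unfolding disagree_def by fastforce
  from node_dom_linear[OF assms(1-3)] show ?thesis
    using *[of \<sigma> \<tau>] *[of \<tau> \<sigma>] sym[of \<tau> \<sigma>] assms(4,5) by blast
qed

text \<open>A proper subnode of \<sigma> is the restriction of \<sigma> to the elements below the
  first one it leaves undecided, so the proper subnodes are indexed by elements of the small set
  \<open>dom \<sigma>\<close>.\<close>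

lemma small_subnodes:
  assumes r: "Well_order r" and s: "node r \<sigma>"
  shows "small {\<rho>. node r \<rho> \<and> \<rho> \<subseteq>\<^sub>m \<sigma>}"
proof (rule small_subset)
  show "small (insert \<sigma> ((\<lambda>e. \<sigma> |` underS r e) ` dom \<sigma>))"
    using small_Un[OF countable_imp_small[of "{\<sigma>}"] small_image[of "dom \<sigma>"]] s
    by (simp add: node_def)
  show "{\<rho>. node r \<rho> \<and> \<rho> \<subseteq>\<^sub>m \<sigma>} \<subseteq> insert \<sigma> ((\<lambda>e. \<sigma> |` underS r e) ` dom \<sigma>)"
  proof
    fix \<rho> assume "\<rho> \<in> {\<rho>. node r \<rho> \<and> \<rho> \<subseteq>\<^sub>m \<sigma>}"
    then have \<rho>: "node r \<rho>" "\<rho> \<subseteq>\<^sub>m \<sigma>" by auto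
    show "\<rho> \<in> insert \<sigma> ((\<lambda>e. \<sigma> |` underS r e) ` dom \<sigma>)"
    proof (cases "dom \<rho> = dom \<sigma>")
      case True
      then have "\<rho> = \<sigma>" using \<rho>(2) by (metis map_le_antisym map_le_def)
      then show ?thesis by simp
    next
      case False
      let ?M = "dom \<sigma> - dom \<rho>"
      have "?M \<noteq> {}" using False map_le_implies_dom_le[OF \<rho>(2)] by blast
      moreover have wf: "wf (r - Id)" using r unfolding well_order_on_def by blast
      ultimately obtain e where e: "e \<in> ?M" "\<And>d. (d, e) \<in> r - Id \<Longrightarrow> d \<notin> ?M"
        using wfE_min'[OF wf] by metis
      have "dom \<rho> = underS r e"
      proof
        show "underS r e \<subseteq> dom \<rho>"
        proof
          fix d assume d: "d \<in> underS r e"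
          then have "d \<in> dom \<sigma>" using s e(1) unfolding node_def by blast
          then show "d \<in> dom \<rho>" using e(2)[of d] d unfolding underS_def by blast
        qed
        show "dom \<rho> \<subseteq> underS r e"
        proof
          fix d assume d: "d \<in> dom \<rho>"
          then have "d \<noteq> e" "e \<notin> underS r d" using e(1) \<rho>(1) unfolding node_def by auto
          moreover have "d \<in> Field r" "e \<in> Field r"
            using d e(1) \<rho>(1) s unfolding node_def by auto
          ultimately show "d \<in> underS r e"
            using r unfolding well_order_on_def linear_order_on_def total_on_def underS_def by blast
        qed
      qed
      then have "\<rho> = \<sigma> |` underS r e"
        using \<rho>(2) unfolding map_le_def restrict_map_def by (auto simp: fun_eq_iff domIff)
      then show ?thesis using e(1) by blast
    qed
  qed
qed

section \<open>Branches of the splitting tree\<close>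

text \<open>
  \<open>H\<close> is a collection of positive sets. It is applied to subsets of \<open>nat\<close> with \<open>\<pi> = id\<close>, and to
  sequences of sets, coded as subsets of \<open>nat \<times> nat\<close>, with \<open>\<pi> = snd\<close>.
\<close>

lemma node_tree_branch:
  fixes H :: "'u set set" and \<pi> :: "'u \<Rightarrow> nat"
  assumes r: "Well_order r" and under: "\<And>e. e \<in> Field r \<Longrightarrow> small (underS r e)"
    and up: "\<And>Y Z. Y \<in> H \<Longrightarrow> Y \<subseteq> Z \<Longrightarrow> Z \<in> H" and empty: "{} \<notin> H"
    and split: "\<And>Y. Y \<in> H \<Longrightarrow> \<exists>e\<in>Field r. \<forall>b. Y \<inter> \<pi> -` side e b \<in> H"
    and Y0: "Y0 \<in> H"
    and N: "\<not> |UNIV :: (nat \<Rightarrow> bool) set| \<le>o |N|"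
  shows "\<exists>\<sigma> (Z :: nat \<Rightarrow> 'u set). node r \<sigma> \<and> (\<forall>j. Z j \<in> H) \<and> Z 0 = Y0 \<and> antimono Z \<and>
           (\<forall>e b. \<sigma> e = Some b \<longrightarrow> (\<exists>j. Z j \<inter> \<pi> -` (- side e b) \<notin> H)) \<and>
           (\<forall>\<nu>\<in>N. \<not> \<sigma> \<subseteq>\<^sub>m \<nu>)"
proof -
  define sp where "sp Y e \<longleftrightarrow> e \<in> Field r \<and> (\<forall>b. Y \<inter> \<pi> -` side e b \<in> H)" for Y e
  have wf: "wf (r - Id)" using r unfolding well_order_on_def by blast
  \<comment> \<open>The least splitter is taken, so that every element below it leaves at most one
    side of \<open>Y\<close> positive.\<close>
  have "\<exists>e. sp Y e \<and> (\<forall>d\<in>underS r e. \<not> sp Y d)" if "Y \<in> H" for Y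
  proof -
    have "\<exists>e. e \<in> Collect (sp Y)" using split[OF that] unfolding sp_def by blast
    then obtain e where "e \<in> Collect (sp Y)" "\<And>d. (d, e) \<in> r - Id \<Longrightarrow> d \<notin> Collect (sp Y)"
      using wfE_min[OF wf] by metis
    then show ?thesis unfolding underS_def by (intro exI[of _ e]) auto
  qed
  then obtain \<alpha> where \<alpha>: "\<And>Y. Y \<in> H \<Longrightarrow> sp Y (\<alpha> Y)"
    and least: "\<And>Y d. Y \<in> H \<Longrightarrow> d \<in> underS r (\<alpha> Y) \<Longrightarrow> \<not> sp Y d" by metis
  \<comment> \<open>\<open>Z f\<close> is the branch coded by \<open>f\<close>: at level
    \<open>n\<close> the side \<open>f n\<close> of the current splitter is kept.\<close>
  define Z where "Z f = rec_nat Y0 (\<lambda>n Y. Y \<inter> \<pi> -` side (\<alpha> Y) (f n))" for f :: "nat \<Rightarrow> bool"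
  have Z0: "Z f 0 = Y0" and ZS: "Z f (Suc n) = Z f n \<inter> \<pi> -` side (\<alpha> (Z f n)) (f n)" for f n
    by (simp_all add: Z_def)
  have ZH: "Z f n \<in> H" for f n
  proof (induction n)
    case (Suc n)
    then show ?case using \<alpha>[OF Suc] unfolding ZS sp_def by blast
  qed (simp add: Z0 Y0)
  have dec: "antimono (Z f)" for f 
    by (rule antimonoI, rule lift_Suc_antimono_le[of "Z f"]) (simp_all add: ZS)
  have opp: "Z f (Suc n) \<inter> \<pi> -` (- side (\<alpha> (Z f n)) (f n)) = {}" for f n
    unfolding ZS by auto
  \<comment> \<open>The old splitter no longer splits, since one of its sides has become empty.
    Whatever splits the smaller set also splits the larger one, so minimality of the old splitter
    keeps the new one from lying below it.\<close>
  have incr: "\<alpha> (Z f n) \<in> underS r (\<alpha> (Z f (Suc n)))" for f n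
  proof -
    let ?d = "\<alpha> (Z f n)" and ?e = "\<alpha> (Z f (Suc n))"
    have F: "?d \<in> Field r" "?e \<in> Field r" using \<alpha>[OF ZH] unfolding sp_def by auto
    have "?e \<noteq> ?d"
    proof
      assume "?e = ?d"
      then have "\<forall>b. Z f (Suc n) \<inter> \<pi> -` side ?d b \<in> H"
        using \<alpha>[OF ZH[of f "Suc n"]] unfolding sp_def by simp
      from this[rule_format, of "\<not> f n"] show False using opp[of f n] empty by simp
    qed
    moreover have "?e \<notin> underS r ?d"
    proof
      assume "?e \<in> underS r ?d"
      then have "\<not> sp (Z f n) ?e" by (rule least[OF ZH])
      moreover have "sp (Z f n) ?e"
        using \<alpha>[OF ZH[of f "Suc n"]] up unfolding sp_def ZS by (meson Int_lower1 Int_mono order_refl)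
      ultimately show False by blast
    qed
    ultimately show ?thesis using F r
      unfolding well_order_on_def linear_order_on_def total_on_def underS_def by blast
  qed
  define D where "D f = (\<Union>n. underS r (\<alpha> (Z f n)))" for f
  \<comment> \<open>\<open>Z f n\<close> has exactly one positive side at every \<open>e\<close> below \<open>\<alpha> (Z f n)\<close>; the limit node chooses
    the side that stays positive along the whole branch.\<close>
  define \<sigma> where "\<sigma> f e = (if e \<in> D f then Some (\<forall>n. Z f n \<inter> \<pi> -` side e True \<in> H) else None)" for f e
  have dom: "dom (\<sigma> f) = D f" for f by (auto simp: \<sigma>_def split: if_splits)
  have trans: "trans r" using r
    unfolding well_order_on_def linear_order_on_def partial_order_on_def preorder_on_def by blast
  have anti: "antisym r" using r
    unfolding well_order_on_def linear_order_on_def partial_order_on_def by blast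
  have node: "node r (\<sigma> f)" for f
    unfolding node_def dom
  proof (intro conjI ballI)
    show "D f \<subseteq> Field r" unfolding D_def underS_def Field_def by blast
    show "underS r e \<subseteq> D f" if e: "e \<in> D f" for e
    proof
      fix d assume "d \<in> underS r e"
      moreover obtain n where "e \<in> underS r (\<alpha> (Z f n))" using e unfolding D_def by blast
      ultimately have "d \<in> underS r (\<alpha> (Z f n))"
        using trans anti unfolding underS_def by (auto dest: transD antisymD)
      then show "d \<in> D f" unfolding D_def by blast
    qed
    show "small (D f)" unfolding D_def
      by (intro small_UN countable_imp_small under) (use \<alpha>[OF ZH] sp_def in auto)
  qed
  \<comment> \<open>Some \<open>Z f n\<close> is not split by \<open>e\<close>. If the true side
    stays positive along the branch, the false side is therefore the one that fails at level
    \<open>n\<close>; otherwise the true side fails at some level by the choice of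
    \<open>b\<close>.\<close>
  have opposite: "\<exists>j. Z f j \<inter> \<pi> -` (- side e b) \<notin> H" if "\<sigma> f e = Some b" for f e b
  proof -
    have e: "e \<in> D f" and b: "b \<longleftrightarrow> (\<forall>n. Z f n \<inter> \<pi> -` side e True \<in> H)"
      using that by (auto simp: \<sigma>_def split: if_splits)
    obtain n where n: "e \<in> underS r (\<alpha> (Z f n))" using e unfolding D_def by blast
    then have "\<not> sp (Z f n) e" by (rule least[OF ZH])
    moreover have "e \<in> Field r" using n unfolding underS_def Field_def by blast
    ultimately obtain c where c: "Z f n \<inter> \<pi> -` side e c \<notin> H" unfolding sp_def by blast
    show ?thesis
    proof (cases b)
      case True
      then have "c = False" using b c by (cases c) auto
      then show ?thesis using c True by (auto simp: side_def)
    next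
      case False
      then obtain k where "Z f k \<inter> \<pi> -` side e True \<notin> H" using b by blast
      then show ?thesis using False by (auto simp: side_def)
    qed
  qed
  \<comment> \<open>The branch \<open>f\<close> can be read off from its limit node at the splitters
    met on the way.\<close>
  have along: "\<sigma> f (\<alpha> (Z f n)) = Some (f n)" for f n
  proof -
    let ?e = "\<alpha> (Z f n)"
    have "?e \<in> D f" using incr unfolding D_def by blast
    moreover have "(\<forall>k. Z f k \<inter> \<pi> -` side ?e True \<in> H) \<longleftrightarrow> f n"
    proof (cases "f n")
      case True
      have "Z f (Suc (max k n)) \<subseteq> Z f k \<inter> \<pi> -` side ?e True" for k
      proof -
        have "Z f (Suc (max k n)) \<subseteq> Z f k" "Z f (Suc (max k n)) \<subseteq> Z f (Suc n)"
          by (auto intro!: antimonoD[OF dec[of f]])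
        then show ?thesis using ZS[of f n] True by auto
      qed
      then show ?thesis using up[OF ZH] True by blast
    next
      case False
      then have "Z f (Suc n) \<inter> \<pi> -` side ?e True = {}" using opp[of f n] by (simp add: side_def)
      then show ?thesis using False empty by metis
    qed
    ultimately show ?thesis by (simp add: \<sigma>_def)
  qed
  have "\<exists>f. \<forall>\<nu>\<in>N. \<not> \<sigma> f \<subseteq>\<^sub>m \<nu>"
  proof (rule ccontr)
    assume "\<not> ?thesis"
    then obtain \<nu> where \<nu>: "\<And>f. \<nu> f \<in> N" "\<And>f. \<sigma> f \<subseteq>\<^sub>m \<nu> f" by metis
    \<comment> \<open>At the first difference of \<open>f\<close> and \<open>g\<close> both branches
      still have the same set and the same splitter, but decide it oppositely. Their limit nodes
      thus have no common extension, and the continuum many branches would need continuum many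
      members of \<open>N\<close>.\<close>
    have "inj \<nu>"
    proof (rule injI, rule ccontr)
      fix f g assume eq: "\<nu> f = \<nu> g" and "f \<noteq> g"
      then have ex: "\<exists>n. f n \<noteq> g n" by auto
      define n where "n = (LEAST n. f n \<noteq> g n)"
      have n: "f n \<noteq> g n" unfolding n_def using ex by (rule LeastI_ex)
      have same: "f k = g k" if "k < n" for k using that not_less_Least unfolding n_def by blast
      have "k \<le> n \<Longrightarrow> Z f k = Z g k" for k by (induction k) (auto simp: Z0 ZS same)
      then have "Z f n = Z g n" by simp
      then have "\<sigma> f (\<alpha> (Z f n)) = Some (f n)" "\<sigma> g (\<alpha> (Z f n)) = Some (g n)"
        using along[of f n] along[of g n] by simp_all
      then have "\<nu> f (\<alpha> (Z f n)) = Some (f n)" "\<nu> g (\<alpha> (Z f n)) = Some (g n)"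
        using \<nu>(2)[of f] \<nu>(2)[of g] unfolding map_le_def by (metis domI)+
      then show False using eq n by simp
    qed
    then have "|UNIV :: (nat \<Rightarrow> bool) set| \<le>o |N|"
      using \<nu>(1) card_of_ordLeq[of UNIV N] by blast
    then show False using N by blast
  qed
  then obtain f where "\<forall>\<nu>\<in>N. \<not> \<sigma> f \<subseteq>\<^sub>m \<nu>" by blast
  then show ?thesis using node[of f] ZH[of f] Z0[of f] dec[of f] opposite[of f] by blast
qed


section \<open>Sets guided by nodes\<close>

type_synonym guide = "(nat \<Rightarrow> nat set) \<times> (nat \<Rightarrow> node)"

definition guide_union :: "guide \<Rightarrow> nat set" where
  "guide_union s = \<Union>(range (fst s))"

text \<open>
  Piece \<open>m\<close> follows the node with index \<open>Suc m\<close>; the node with index \<open>0\<close> is followed by the tails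
  of the union of all pieces.
\<close>

definition guided :: "guide \<Rightarrow> bool" where
  "guided s \<longleftrightarrow>
     (\<forall>m e b. snd s (Suc m) e = Some b \<longrightarrow> finite (fst s m - side e b)) \<and>
     (\<forall>e b. snd s 0 e = Some b \<longrightarrow> (\<exists>k. finite (\<Union>(fst s ` {k..}) - side e b)))"

text \<open>The conflict with node \<open>0\<close> disposes of all pieces from some index
  \<open>l\<close> on at once; the remaining pieces are finitely many and are handled one at a time
  by their own conflicts. A decreasing sequence \<open>X\<close> is allowed so that the lemma serves
  tails of a union as well as a single set.\<close>

lemma guided_tail_finite:
  assumes s: "guided s" and X: "antimono X"
    and \<sigma>: "\<And>e b. \<sigma> e = Some b \<Longrightarrow> \<exists>k :: nat. finite (X k - side e b)"
    and dis: "\<And>m. disagree \<sigma> (snd s m)"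
  shows "\<exists>k. finite (X k \<inter> guide_union s)"
proof -
  have tail: "\<exists>k. finite (X k \<inter> Y)" if eb: "\<sigma> e = Some b" and Y: "finite (Y - side e (\<not> b))" for e b Y
  proof -
    obtain k where k: "finite (X k - side e b)" using \<sigma>[OF eb] by blast
    have "X k \<inter> Y \<subseteq> (X k - side e b) \<union> (Y - side e (\<not> b))" by auto
    then show ?thesis using k Y by (meson finite_UnI finite_subset)
  qed
  have "\<exists>k. finite (X k \<inter> fst s m)" for m
  proof -
    obtain e b where "\<sigma> e = Some b" "snd s (Suc m) e = Some (\<not> b)"
      using dis[of "Suc m"] unfolding disagree_def by blast
    then show ?thesis using tail[of e b "fst s m"] s unfolding guided_def by blast
  qed
  then obtain K where K: "\<And>m. finite (X (K m) \<inter> fst s m)" by metis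
  obtain e b where eb: "\<sigma> e = Some b" "snd s 0 e = Some (\<not> b)"
    using dis[of 0] unfolding disagree_def by blast
  then obtain l where "finite (\<Union>(fst s ` {l..}) - side e (\<not> b))"
    using s unfolding guided_def by blast
  then obtain k0 where k0: "finite (X k0 \<inter> \<Union>(fst s ` {l..}))" using tail[OF eb(1)] by blast
  \<comment> \<open>The sum exceeds each of the finitely many indices \<open>K m\<close>, so
    \<open>X ?k\<close> lies inside all the sets \<open>X (K m)\<close> with \<open>m < l\<close>,
    and inside \<open>X k0\<close>.\<close>
  let ?k = "k0 + (\<Sum>m<l. K m)"
  have "X ?k \<subseteq> X k0" by (rule antimonoD[OF X]) simp
  moreover have "X ?k \<subseteq> X (K m)" if "m < l" for m
    by (rule antimonoD[OF X]) (use that member_le_sum[of m "{..<l}" K] in auto)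
  ultimately have sub: "X ?k \<inter> guide_union s
      \<subseteq> (X k0 \<inter> \<Union>(fst s ` {l..})) \<union> (\<Union>m\<in>{..<l}. X (K m) \<inter> fst s m)"
  proof (intro subsetI)
    fix y assume y: "y \<in> X ?k \<inter> guide_union s"
    then obtain m where m: "y \<in> fst s m" unfolding guide_union_def by blast
    show "y \<in> (X k0 \<inter> \<Union>(fst s ` {l..})) \<union> (\<Union>m\<in>{..<l}. X (K m) \<inter> fst s m)"
    proof (cases "m < l")
      case True
      then show ?thesis using y m \<open>m < l \<Longrightarrow> X ?k \<subseteq> X (K m)\<close> by blast
    next
      case False
      then show ?thesis using y m \<open>X ?k \<subseteq> X k0\<close> by fastforce
    qed
  qed
  have "finite (\<Union>m\<in>{..<l}. X (K m) \<inter> fst s m)" using K by blast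
  then show ?thesis using k0 finite_subset[OF sub] by blast
qed

section \<open>Diagonalisation and positive sets\<close>

text \<open>Take one point \<open>u n\<close> from each \<open>c n\<close>, beyond a bound
  \<open>g n\<close> that for every member \<open>a\<close> of \<open>B\<close> eventually exceeds
  the finite set \<open>c n \<inter> a\<close>. The condition \<open>n \<le> u n\<close> makes the
  range infinite.\<close>

lemma diagonal_set:
  assumes B: "small B" and c: "\<And>n :: nat. infinite (c n :: nat set)"
    and fin: "\<And>a. a \<in> B \<Longrightarrow> \<forall>\<^sub>\<infinity>n. finite (c n \<inter> a)"
  shows "\<exists>x. infinite x \<and> (\<forall>n. finite (x - \<Union>(c ` {n..}))) \<and> x \<subseteq> \<Union>(range c) \<and> (\<forall>a\<in>B. finite (x \<inter> a))"
proof -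
  have "\<exists>g. \<forall>a\<in>B. \<forall>\<^sub>\<infinity>n. \<forall>k\<ge>g n. k \<notin> c n \<inter> a"
  proof (rule small_pred_bound[OF B])
    fix a assume "a \<in> B"
    from fin[OF this] show "\<forall>\<^sub>\<infinity>n. \<exists>m. \<forall>k\<ge>m. k \<notin> c n \<inter> a"
      by (rule MOST_mono) (metis infinite_nat_iff_unbounded_le)
  qed
  then obtain g where g: "\<And>a. a \<in> B \<Longrightarrow> \<forall>\<^sub>\<infinity>n. \<forall>k\<ge>g n. k \<notin> c n \<inter> a" by blast
  have "\<exists>k. k \<in> c n \<and> max (g n) n \<le> k" for n
    using c[of n] unfolding infinite_nat_iff_unbounded_le by blast
  then obtain u where u: "\<And>n. u n \<in> c n" "\<And>n. g n \<le> u n" "\<And>n. n \<le> u n"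
    by (metis max.bounded_iff)
  have "infinite (range u)"
    unfolding infinite_nat_iff_unbounded_le using u(3) by blast
  moreover have "finite (range u - \<Union>(c ` {n..}))" for n
  proof (rule finite_subset)
    show "range u - \<Union>(c ` {n..}) \<subseteq> u ` {..<n}"
    proof
      fix y assume y: "y \<in> range u - \<Union>(c ` {n..})"
      then obtain m where m: "y = u m" by blast
      then have "m < n" using y u(1)[of m] by (metis DiffD2 UN_I atLeast_iff leI)
      then show "y \<in> u ` {..<n}" using m by simp
    qed
  qed simp
  moreover have "finite (range u \<inter> a)" if "a \<in> B" for a
  proof -
    obtain N where N: "\<And>n. n \<ge> N \<Longrightarrow> \<forall>k\<ge>g n. k \<notin> c n \<inter> a"
      using g[OF \<open>a \<in> B\<close>] unfolding MOST_nat_le by blast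
    have "range u \<inter> a \<subseteq> u ` {..<N}"
    proof
      fix y assume y: "y \<in> range u \<inter> a"
      then obtain m where m: "y = u m" by blast
      then have "\<not> N \<le> m" using N[of m] u(1,2)[of m] y by blast
      then show "y \<in> u ` {..<N}" using m by simp
    qed
    then show ?thesis by (rule finite_subset) simp
  qed
  ultimately show ?thesis using u(1) by (intro exI[of _ "range u"]) blast
qed

lemma mem_ideal_positive_iff: "x \<in> ideal_positive A \<longleftrightarrow> (\<forall>F\<subseteq>A. finite F \<longrightarrow> infinite (x - \<Union>F))"
  by (simp add: ideal_positive_def mem_ideal_gen_iff) blast

lemma ideal_positive_mono: "x \<in> ideal_positive A \<Longrightarrow> x \<subseteq> y \<Longrightarrow> y \<in> ideal_positive A"
  unfolding mem_ideal_positive_iff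
proof (intro allI impI)
  fix F assume "\<forall>F\<subseteq>A. finite F \<longrightarrow> infinite (x - \<Union>F)" "x \<subseteq> y" "F \<subseteq> A" "finite F"
  then show "infinite (y - \<Union>F)" by (intro infinite_super[of "x - \<Union>F" "y - \<Union>F"]) auto
qed

lemma ideal_positive_if_almost_disjoint_subset:
  assumes "infinite y" "y \<subseteq> x" and fin: "\<And>a. a \<in> A \<Longrightarrow> finite (y \<inter> a)"
  shows "x \<in> ideal_positive A"
  unfolding mem_ideal_positive_iff
proof (intro allI impI notI)
  fix F assume F: "F \<subseteq> A" "finite F" "finite (x - \<Union>F)"
  have "y \<subseteq> (x - \<Union>F) \<union> (\<Union>a\<in>F. y \<inter> a)" using assms(2) by auto
  moreover have "finite (\<Union>a\<in>F. y \<inter> a)" using F fin by blast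
  ultimately show False using assms(1) F(3) by (meson finite_UnI finite_subset)
qed

text \<open>Given a finite subfamily, some member outside it has infinite trace on \<open>x\<close>,
  and almost disjointness leaves almost all of that trace uncovered.\<close>

lemma ideal_positive_if_meets_infinitely_many:
  assumes A: "almost_disjoint A" and inf: "infinite {a\<in>A. infinite (x \<inter> a)}"
  shows "x \<in> ideal_positive A"
  unfolding mem_ideal_positive_iff
proof (intro allI impI notI)
  fix F assume F: "F \<subseteq> A" "finite F" "finite (x - \<Union>F)"
  obtain a where a: "a \<in> A" "infinite (x \<inter> a)" "a \<notin> F"
    using infinite_super[OF _ inf, of F] F(2) by blast
  have "x \<inter> a \<subseteq> (x - \<Union>F) \<union> (\<Union>c\<in>F. c \<inter> a)" by auto
  moreover have "finite (c \<inter> a)" if "c \<in> F" for c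
    using A that a(1,3) F(1) unfolding almost_disjoint_def pairwise_def by (metis subsetD)
  then have "finite (\<Union>c\<in>F. c \<inter> a)" using F(2) by blast
  ultimately show False using a(2) F(3) by (meson finite_UnI finite_subset)
qed

text \<open>Positivity survives the removal of finitely many members, and removing exactly those
  with infinite trace leaves a set almost disjoint from the whole family.\<close>

lemma infinite_diff_traces:
  assumes x: "x \<in> ideal_positive A" and fin: "finite {a\<in>A. infinite (x \<inter> a)}"
    and y: "y = x - \<Union>{a\<in>A. infinite (x \<inter> a)}"
  shows "infinite y" and "a \<in> A \<Longrightarrow> finite (y \<inter> a)"
proof -
  show "infinite y" using x fin unfolding y mem_ideal_positive_iff by auto
  assume a: "a \<in> A"
  show "finite (y \<inter> a)"
  proof (cases "infinite (x \<inter> a)")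
    case True
    then have "y \<inter> a = {}" using a y by blast
    then show ?thesis by simp
  next
    case False
    then show ?thesis using y by (meson Diff_subset Int_mono finite_subset order_refl)
  qed
qed

text \<open>If infinitely many members have infinite trace on \<open>x\<close>, splitting a sequence
  of such traces leaves infinitely many infinite traces on both sides. Otherwise \<open>x\<close>
  contains an infinite set almost disjoint from the family, and splitting the constant sequence at
  that set suffices.\<close>

lemma ideal_positive_split:
  assumes A: "almost_disjoint A" and E: "omega_omega_splitting E" and x: "x \<in> ideal_positive A"
  shows "\<exists>e\<in>E. \<forall>c. x \<inter> side e c \<in> ideal_positive A"
proof (cases "finite {a\<in>A. infinite (x \<inter> a)}")
  case False
  then obtain a :: "nat \<Rightarrow> nat set" where a: "inj a" "range a \<subseteq> {a\<in>A. infinite (x \<inter> a)}"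
    using infinite_countable_subset by blast
  then have "\<forall>n. infinite (x \<inter> a n)" by auto
  then obtain e where e: "e \<in> E" "\<exists>\<^sub>\<infinity>n. infinite (x \<inter> a n \<inter> e)" "\<exists>\<^sub>\<infinity>n. infinite (x \<inter> a n \<inter> - e)"
    using E unfolding omega_omega_splitting_def by meson
  then have *: "\<exists>\<^sub>\<infinity>n. infinite (x \<inter> side e c \<inter> a n)" for c
    by (cases c) (simp_all add: side_def Int_ac)
  have "x \<inter> side e c \<in> ideal_positive A" for c
  proof (rule ideal_positive_if_meets_infinitely_many[OF A])
    have "infinite (a ` {n. infinite (x \<inter> side e c \<inter> a n)})"
      using * a(1) by (simp add: INFM_iff_infinite finite_image_iff inj_on_subset)
    then show "infinite {b\<in>A. infinite (x \<inter> side e c \<inter> b)}"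
      by (rule infinite_super[rotated]) (use a(2) in auto)
  qed
  then show ?thesis using e(1) by blast
next
  case True
  let ?y = "x - \<Union>{a\<in>A. infinite (x \<inter> a)}"
  note y = infinite_diff_traces[OF x True refl]
  then obtain e where e: "e \<in> E" "infinite (?y \<inter> e)" "infinite (?y \<inter> - e)"
    using E[unfolded omega_omega_splitting_def, THEN conjunct2, rule_format, of "\<lambda>_. ?y"] by auto
  have "x \<inter> side e c \<in> ideal_positive A" for c
  proof (rule ideal_positive_if_almost_disjoint_subset)
    show "infinite (?y \<inter> side e c)" using e(2,3) by (cases c) (simp_all add: side_def)
    show "?y \<inter> side e c \<subseteq> x \<inter> side e c" by blast
    show "finite (?y \<inter> side e c \<inter> a)" if "a \<in> A" for a
      by (rule finite_subset[OF _ y(2)[OF that]]) blast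
  qed
  then show ?thesis using e(1) by blast
qed

lemma inj_choice:
  fixes K :: "nat \<Rightarrow> 'a set"
  assumes "\<And>n. infinite (K n)"
  shows "\<exists>a. inj a \<and> (\<forall>n. a n \<in> K n)"
proof -
  \<comment> \<open>The state of the recursion pairs the finite set of values already taken with the
    current value.\<close>
  have "\<exists>f. \<forall>n. (finite (fst (f n)) \<and> snd (f n) \<in> K n - fst (f n)) \<and>
           fst (f (Suc n)) = insert (snd (f n)) (fst (f n))"
  proof (rule dependent_nat_choice)
    show "\<exists>p. finite (fst p) \<and> snd p \<in> K 0 - fst p"
      using assms[of 0] by (metis Diff_empty finite.emptyI fst_conv snd_conv ex_in_conv)
    fix p :: "'a set \<times> 'a" and n
    assume "finite (fst p) \<and> snd p \<in> K n - fst p"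
    then have "infinite (K (Suc n) - insert (snd p) (fst p))" using assms by simp
    then obtain a where "a \<in> K (Suc n) - insert (snd p) (fst p)" by (metis ex_in_conv finite.emptyI)
    then show "\<exists>q. (finite (fst q) \<and> snd q \<in> K (Suc n) - fst q) \<and> fst q = insert (snd p) (fst p)"
      using \<open>finite (fst p) \<and> _\<close> by (intro exI[of _ "(insert (snd p) (fst p), a)"]) simp
  qed
  then obtain f where f: "\<And>n. snd (f n) \<in> K n - fst (f n)"
    and fS: "\<And>n. fst (f (Suc n)) = insert (snd (f n)) (fst (f n))" by blast
  have "snd (f m) \<in> fst (f n)" if "m < n" for m n
    using that by (induction n) (auto simp: fS less_Suc_eq)
  then have "snd (f m) \<noteq> snd (f n)" if "m < n" for m n using f[of n] that by force
  then have "inj (\<lambda>n. snd (f n))" by (meson linorder_inj_onI' )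
  then show ?thesis using f by blast
qed

text \<open>Prepares the input of \<open>diagonal_set\<close>. Either distinct members can be chosen
  with infinite traces on the successive \<open>Z n\<close>, and a given member equals at most one
  of them; or some \<open>Z N\<close> has only finitely many infinite traces, and these can be
  removed from all later sets.\<close>

lemma decreasing_ideal_positive:
  assumes Z: "antimono Z" "\<And>n :: nat. Z n \<in> ideal_positive A" and A: "almost_disjoint A"
  shows "\<exists>c. (\<forall>n. infinite (c n) \<and> c n \<subseteq> Z n) \<and> (\<forall>a\<in>A. \<forall>\<^sub>\<infinity>n. finite (c n \<inter> a))"
proof (cases "\<forall>n. infinite {a\<in>A. infinite (Z n \<inter> a)}")
  case True
  then obtain a where a: "inj a" "\<And>n. a n \<in> {a\<in>A. infinite (Z n \<inter> a)}"
    using inj_choice[of "\<lambda>n. {a\<in>A. infinite (Z n \<inter> a)}"] by blast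
  have "\<forall>\<^sub>\<infinity>n. finite (Z n \<inter> a n \<inter> d)" if d: "d \<in> A" for d
  proof -
    have "finite (Z n \<inter> a n \<inter> d)" if "a n \<noteq> d" for n
    proof -
      have "finite (a n \<inter> d)"
        using A a(2)[of n] d that unfolding almost_disjoint_def pairwise_def by blast
      then show ?thesis by (rule finite_subset[rotated]) blast
    qed
    then have "{n. \<not> finite (Z n \<inter> a n \<inter> d)} \<subseteq> a -` {d}" by blast
    moreover have "finite (a -` {d})" using a(1) by (intro finite_vimageI) auto
    ultimately show ?thesis unfolding MOST_iff_cofinite by (rule finite_subset)
  qed
  then show ?thesis using a(2) by (intro exI[of _ "\<lambda>n. Z n \<inter> a n"]) auto
next
  case False
  then obtain N where N: "finite {a\<in>A. infinite (Z N \<inter> a)}" by blast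
  let ?K = "{a\<in>A. infinite (Z N \<inter> a)}"
  \<comment> \<open>The shift by \<open>N\<close> places every \<open>c n\<close> inside
    \<open>Z N\<close>, where the traces are under control, as well as inside
    \<open>Z n\<close>.\<close>
  define c where "c n = Z (n + N) - \<Union>?K" for n
  have "infinite (c n)" for n
    using Z(2)[of "n + N"] N unfolding c_def mem_ideal_positive_iff by auto
  moreover have "c n \<subseteq> Z n" for n using antimonoD[OF Z(1), of n "n + N"] unfolding c_def by auto
  moreover have "finite (c n \<inter> a)" if "a \<in> A" for n a
  proof (rule finite_subset)
    show "finite ((Z N - \<Union>?K) \<inter> a)" by (rule infinite_diff_traces(2)[OF Z(2) N refl that])
    show "c n \<inter> a \<subseteq> (Z N - \<Union>?K) \<inter> a"
      using antimonoD[OF Z(1), of N "n + N"] unfolding c_def by auto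
  qed
  ultimately show ?thesis by (intro exI[of _ c]) simp
qed

section \<open>Systems of guides\<close>

text \<open>The countability clause turns smallness of a set of nodes into smallness of the set of
  guides using them.\<close>

definition guide_system :: "nat set rel \<Rightarrow> guide set \<Rightarrow> bool" where
  "guide_system r S \<longleftrightarrow>
     (\<forall>s\<in>S. guided s \<and> infinite (guide_union s) \<and> (\<forall>m. node r (snd s m))) \<and>
     pairwise (\<lambda>s t. finite (guide_union s \<inter> guide_union t)) S \<and>
     (\<forall>\<rho>. countable {s\<in>S. \<rho> \<in> range (snd s)})"

definition nodes :: "guide set \<Rightarrow> node set" where
  "nodes S = (\<Union>s\<in>S. range (snd s))"

lemma guide_system_almost_disjoint: "guide_system r S \<Longrightarrow> almost_disjoint (guide_union ` S)"
  unfolding guide_system_def almost_disjoint_def pairwise_def by (simp, metis)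

lemma guide_system_small:
  assumes "Well_order r" and S: "guide_system r S" and "node r \<sigma>"
  shows "small {s\<in>S. \<exists>m. snd s m \<subseteq>\<^sub>m \<sigma>}"
proof (rule small_subset)
  show "small (\<Union>\<rho>\<in>{\<rho>. node r \<rho> \<and> \<rho> \<subseteq>\<^sub>m \<sigma>}. {s\<in>S. \<rho> \<in> range (snd s)})"
    using S unfolding guide_system_def
    by (intro small_UN small_subnodes[OF assms(1,3)] countable_imp_small) blast
  show "{s\<in>S. \<exists>m. snd s m \<subseteq>\<^sub>m \<sigma>}
      \<subseteq> (\<Union>\<rho>\<in>{\<rho>. node r \<rho> \<and> \<rho> \<subseteq>\<^sub>m \<sigma>}. {s\<in>S. \<rho> \<in> range (snd s)})"
    using S unfolding guide_system_def by blast
qed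

text \<open>No node of \<open>s\<close> extends \<sigma> because \<sigma> is new, and none is
  extended by \<sigma> by assumption on \<open>s\<close>; hence all of them disagree with \<sigma>.
  Only the small set of guides from \<open>guide_system_small\<close> needs further
  attention.\<close>

lemma guide_system_tail_finite:
  assumes r: "Well_order r" and S: "guide_system r S" and \<sigma>: "node r \<sigma>"
    and new: "\<And>\<nu>. \<nu> \<in> nodes S \<Longrightarrow> \<not> \<sigma> \<subseteq>\<^sub>m \<nu>"
    and s: "s \<in> S" "\<nexists>m. snd s m \<subseteq>\<^sub>m \<sigma>"
    and X: "antimono X" "\<And>e b. \<sigma> e = Some b \<Longrightarrow> \<exists>k :: nat. finite (X k - side e b)"
  shows "\<exists>k. finite (X k \<inter> guide_union s)"
proof (rule guided_tail_finite[OF _ X])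
  show "guided s" using S s(1) unfolding guide_system_def by blast
  show "disagree \<sigma> (snd s m)" for m
  proof (rule node_disagree[OF r \<sigma>])
    show "node r (snd s m)" using S s(1) unfolding guide_system_def by blast
    show "\<not> \<sigma> \<subseteq>\<^sub>m snd s m" using new s(1) unfolding nodes_def by blast
    show "\<not> snd s m \<subseteq>\<^sub>m \<sigma>" using s(2) by blast
  qed
qed

section \<open>One step of the construction\<close>

text \<open>A branch through positive subsets of \<open>b\<close> yields a new node \<tau>.
  Diagonalising along the branch while avoiding a small subfamily gives \<open>x\<close>; the rest
  of the family is avoided because its nodes disagree with \<tau>.\<close>

lemma new_piece:
  assumes r: "Well_order r" and under: "\<And>e. e \<in> Field r \<Longrightarrow> small (underS r e)"
    and E: "omega_omega_splitting (Field r)" and S: "guide_system r S"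
    and N: "\<not> |UNIV :: (nat \<Rightarrow> bool) set| \<le>o |nodes S|"
    and b: "b \<in> ideal_positive (guide_union ` S)"
  shows "\<exists>x \<tau>. infinite x \<and> x \<subseteq> b \<and> node r \<tau> \<and> (\<forall>\<nu>\<in>nodes S. \<not> \<tau> \<subseteq>\<^sub>m \<nu>) \<and>
           (\<forall>e c. \<tau> e = Some c \<longrightarrow> finite (x - side e c)) \<and> (\<forall>s\<in>S. finite (x \<inter> guide_union s))"
proof -
  let ?A = "guide_union ` S"
  note A = guide_system_almost_disjoint[OF S]
  have empty: "{} \<notin> ideal_positive ?A" by (auto simp: mem_ideal_positive_iff)
  have split: "\<exists>e\<in>Field r. \<forall>c. y \<inter> id -` side e c \<in> ideal_positive ?A"
    if "y \<in> ideal_positive ?A" for y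
    using ideal_positive_split[OF A E that] by simp
  have "\<exists>\<tau> (Z :: nat \<Rightarrow> nat set). node r \<tau> \<and> (\<forall>j. Z j \<in> ideal_positive ?A) \<and> Z 0 = b \<and> antimono Z \<and>
      (\<forall>e c. \<tau> e = Some c \<longrightarrow> (\<exists>j. Z j \<inter> id -` (- side e c) \<notin> ideal_positive ?A)) \<and>
      (\<forall>\<nu>\<in>nodes S. \<not> \<tau> \<subseteq>\<^sub>m \<nu>)"
    by (rule node_tree_branch[OF r _ _ _ _ b N]) (fact under ideal_positive_mono empty split)+
  then obtain \<tau> Z where \<tau>: "node r \<tau>" "\<And>\<nu>. \<nu> \<in> nodes S \<Longrightarrow> \<not> \<tau> \<subseteq>\<^sub>m \<nu>"
    and Z: "\<And>j :: nat. Z j \<in> ideal_positive ?A" "Z 0 = b" "antimono Z"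
    and opp: "\<And>e c. \<tau> e = Some c \<Longrightarrow> \<exists>j. Z j \<inter> - side e c \<notin> ideal_positive ?A"
    unfolding vimage_id id_apply by blast
  obtain c where c: "\<And>n. infinite (c n)" "\<And>n. c n \<subseteq> Z n"
    and cA: "\<And>a. a \<in> ?A \<Longrightarrow> \<forall>\<^sub>\<infinity>n. finite (c n \<inter> a)"
    using decreasing_ideal_positive[OF Z(3,1) A] by metis
  \<comment> \<open>The rejected side of \<open>e\<close> is eventually not positive, so finitely
    many members \<open>F e\<close> cover almost all of it.\<close>
  have "\<forall>e\<in>dom \<tau>. \<exists>j F. F \<subseteq> ?A \<and> finite F \<and> finite (Z j \<inter> - side e (the (\<tau> e)) - \<Union>F)"
  proof
    fix e assume "e \<in> dom \<tau>"
    then obtain j where "Z j \<inter> - side e (the (\<tau> e)) \<notin> ideal_positive ?A"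
      using opp[of e "the (\<tau> e)"] by auto
    then show "\<exists>j F. F \<subseteq> ?A \<and> finite F \<and> finite (Z j \<inter> - side e (the (\<tau> e)) - \<Union>F)"
      unfolding mem_ideal_positive_iff by blast
  qed
  then obtain J F where F: "\<And>e. e \<in> dom \<tau> \<Longrightarrow> F e \<subseteq> ?A \<and> finite (F e) \<and>
      finite (Z (J e) \<inter> - side e (the (\<tau> e)) - \<Union>(F e))" by metis
  \<comment> \<open>Two kinds of members must be avoided by hand: those with a node below \<tau>,
    and the covers \<open>F e\<close>. Avoiding the latter forces \<open>x\<close> almost into the
    side chosen by \<tau>.\<close>
  define B where "B = guide_union ` {s\<in>S. \<exists>m. snd s m \<subseteq>\<^sub>m \<tau>} \<union> (\<Union>e\<in>dom \<tau>. F e)"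
  have "small (dom \<tau>)" using \<tau>(1) unfolding node_def by blast
  then have sB: "small B" unfolding B_def
    by (intro small_Un small_image guide_system_small[OF r S \<tau>(1)] small_UN)
      (use F in \<open>auto intro: countable_imp_small countable_finite\<close>)
  have "B \<subseteq> ?A" unfolding B_def using F by blast
  then have "\<exists>x. infinite x \<and> (\<forall>n. finite (x - \<Union>(c ` {n..}))) \<and> x \<subseteq> \<Union>(range c) \<and> (\<forall>a\<in>B. finite (x \<inter> a))"
    by (intro diagonal_set sB c(1) cA) blast
  then obtain x where x: "infinite x" "x \<subseteq> \<Union>(range c)"
    and xc: "\<And>n. finite (x - \<Union>(c ` {n..}))" and xB: "\<And>a. a \<in> B \<Longrightarrow> finite (x \<inter> a)"
    by blast
  have Zle: "Z m \<subseteq> Z n" if "n \<le> m" for n m by (rule antimonoD[OF Z(3) that])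
  have xZ: "finite (x - Z j)" for j
    by (rule finite_subset[OF _ xc[of j]]) (use c(2) Zle in fastforce)
  have "x \<subseteq> b" using x(2) c(2) Zle[of 0] Z(2) by blast
  moreover have side: "finite (x - side e d)" if "\<tau> e = Some d" for e d
  proof -
    have e: "e \<in> dom \<tau>" and d: "the (\<tau> e) = d" using that by auto
    have "F e \<subseteq> B" using e unfolding B_def by blast
    then have "finite (\<Union>a\<in>F e. x \<inter> a)" using F[OF e] xB by (intro finite_UN_I) blast+
    moreover have "x - side e d \<subseteq>
        (x - Z (J e)) \<union> (Z (J e) \<inter> - side e d - \<Union>(F e)) \<union> (\<Union>a\<in>F e. x \<inter> a)" by auto
    moreover have "finite (Z (J e) \<inter> - side e d - \<Union>(F e))" using F[OF e] d by simp
    ultimately show ?thesis using xZ[of "J e"] by (metis finite_UnI finite_subset)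
  qed
  moreover have "finite (x \<inter> guide_union s)" if s: "s \<in> S" for s
  proof (cases "\<exists>m. snd s m \<subseteq>\<^sub>m \<tau>")
    case True
    then show ?thesis using xB s unfolding B_def by blast
  next
    case False
    then show ?thesis
      using guide_system_tail_finite[OF r S \<tau> s, of "\<lambda>_. x"] side by (auto simp: antimono_def)
  qed
  ultimately show ?thesis using x(1) \<tau> by (intro exI[of _ x] exI[of _ \<tau>] conjI) auto
qed

text \<open>After one piece is found inside each \<open>b n\<close>, the tree argument is run once
  more, on the sequence of pieces. Its limit node \<sigma> becomes node \<open>0\<close> and
  controls the tails of the union.\<close>

lemma new_guide:
  assumes r: "Well_order r" and under: "\<And>e. e \<in> Field r \<Longrightarrow> small (underS r e)"
    and E: "omega_omega_splitting (Field r)" and S: "guide_system r S"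
    and N: "\<not> |UNIV :: (nat \<Rightarrow> bool) set| \<le>o |nodes S|"
    and b: "\<And>n :: nat. b n \<in> ideal_positive (guide_union ` S)"
  shows "\<exists>s. guided s \<and> infinite (guide_union s) \<and> (\<forall>m. node r (snd s m)) \<and>
           (\<forall>m. \<forall>\<nu>\<in>nodes S. \<not> snd s m \<subseteq>\<^sub>m \<nu>) \<and> (\<forall>t\<in>S. finite (guide_union s \<inter> guide_union t)) \<and>
           (\<exists>\<^sub>\<infinity>n. infinite (b n \<inter> guide_union s))"
proof -
  have "\<forall>n. \<exists>x \<tau>. infinite x \<and> x \<subseteq> b n \<and> node r \<tau> \<and> (\<forall>\<nu>\<in>nodes S. \<not> \<tau> \<subseteq>\<^sub>m \<nu>) \<and>
           (\<forall>e c. \<tau> e = Some c \<longrightarrow> finite (x - side e c)) \<and> (\<forall>s\<in>S. finite (x \<inter> guide_union s))"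
    using new_piece[OF r under E S N b] by blast
  then obtain x \<tau> where x: "\<And>n. infinite (x n)" "\<And>n. x n \<subseteq> b n"
    and \<tau>: "\<And>n. node r (\<tau> n)" "\<And>n \<nu>. \<nu> \<in> nodes S \<Longrightarrow> \<not> \<tau> n \<subseteq>\<^sub>m \<nu>"
    and x\<tau>: "\<And>n e c. \<tau> n e = Some c \<Longrightarrow> finite (x n - side e c)"
    and xS: "\<And>n s. s \<in> S \<Longrightarrow> finite (x n \<inter> guide_union s)" by metis
  \<comment> \<open>A sequence of sets counts as positive if infinitely many of its terms are
    infinite.\<close>
  define H where "H = {Y :: (nat \<times> nat) set. \<exists>\<^sub>\<infinity>n. infinite (Y `` {n})}"
  have "\<exists>e\<in>Field r. \<forall>c. Y \<inter> snd -` side e c \<in> H" if Y: "Y \<in> H" for Y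
  proof -
    let ?I = "{n. infinite (Y `` {n})}"
    have I: "infinite ?I" using Y unfolding H_def INFM_iff_infinite by simp
    \<comment> \<open>Splitting applies to sequences of infinite sets, so only the infinite columns
      are listed.\<close>
    then have "\<forall>n. infinite (Y `` {enumerate ?I n})" using enumerate_in_set by blast
    then obtain e where e: "e \<in> Field r" "\<exists>\<^sub>\<infinity>n. infinite (Y `` {enumerate ?I n} \<inter> e)"
        "\<exists>\<^sub>\<infinity>n. infinite (Y `` {enumerate ?I n} \<inter> - e)"
      using E[unfolded omega_omega_splitting_def, THEN conjunct2, rule_format,
          of "\<lambda>n. Y `` {enumerate ?I n}"] by blast
    have "Y \<inter> snd -` side e c \<in> H" for c
    proof -
      let ?M = "{n. infinite (Y `` {enumerate ?I n} \<inter> side e c)}"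
      have "infinite ?M"
        using e(2,3) by (cases c) (simp_all add: side_def INFM_iff_infinite)
      then have "infinite (enumerate ?I ` ?M)"
        using strict_mono_imp_inj_on[OF strict_mono_enumerate[OF I]]
        by (simp add: finite_image_iff inj_on_subset)
      moreover have "(Y \<inter> snd -` side e c) `` {n} = Y `` {n} \<inter> side e c" for n by auto
      then have "enumerate ?I ` ?M \<subseteq> {n. infinite ((Y \<inter> snd -` side e c) `` {n})}" by auto
      ultimately show ?thesis unfolding H_def INFM_iff_infinite using infinite_super by blast
    qed
    then show ?thesis using e(1) by blast
  qed
  moreover have "Z \<in> H" if "Y \<in> H" "Y \<subseteq> Z" for Y Z
  proof -
    have "infinite (Z `` {n})" if "infinite (Y `` {n})" for n
      by (rule infinite_super[OF _ that]) (use \<open>Y \<subseteq> Z\<close> in blast)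
    then show ?thesis using \<open>Y \<in> H\<close> unfolding H_def by (auto elim: INFM_mono)
  qed
  moreover have "{} \<notin> H" unfolding H_def by simp
  moreover have "Sigma UNIV x \<in> H" unfolding H_def using x(1) by (simp add: Image_def)
  ultimately obtain \<sigma> and Z :: "nat \<Rightarrow> (nat \<times> nat) set"
    where \<sigma>: "node r \<sigma>" "\<And>\<nu>. \<nu> \<in> nodes S \<Longrightarrow> \<not> \<sigma> \<subseteq>\<^sub>m \<nu>"
      and Z: "\<And>j. Z j \<in> H" "Z 0 = Sigma UNIV x" "antimono Z"
      and opp: "\<And>e c. \<sigma> e = Some c \<Longrightarrow> \<exists>j. Z j \<inter> snd -` (- side e c) \<notin> H"
    using node_tree_branch[OF r under _ _ _ _ N, of H snd "Sigma UNIV x"] by blast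
  have Zle: "Z m \<subseteq> Z n" if "n \<le> m" for n m by (rule antimonoD[OF Z(3) that])
  \<comment> \<open>A diagonal through the branch: an infinite column of each \<open>Z j\<close>,
    with increasing indices.\<close>
  have "\<exists>i. \<forall>j :: nat. infinite (Z j `` {i j}) \<and> i j < i (Suc j)"
  proof (rule dependent_nat_choice)
    have *: "\<exists>m>n. infinite (Z j `` {m})" for j n
      using Z(1)[of j] unfolding H_def INFM_nat by blast
    show "\<exists>m. infinite (Z 0 `` {m})" using * by blast
    show "\<exists>m. infinite (Z (Suc j) `` {m}) \<and> n < m" for n j using * by blast
  qed
  then obtain i where Zi: "\<And>j. infinite (Z j `` {i j})" and "\<And>j. i j < i (Suc j)" by blast
  then have i: "strict_mono i" by (simp add: strict_mono_Suc_iff)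
  define c where "c j = Z j `` {i j}" for j
  have cx: "c j \<subseteq> x (i j)" for j using Zle[of 0 j] Z(2) unfolding c_def by auto
  \<comment> \<open>The rejected side of \<open>Z k\<close> has only finitely many infinite columns;
    for large \<open>j\<close> the column \<open>c j\<close> lies in one of the others, since
    \<open>i j\<close> is at least \<open>j\<close>.\<close>
  have c\<sigma>: "\<forall>\<^sub>\<infinity>j. finite (c j - side e d)" if ed: "\<sigma> e = Some d" for e d
  proof -
    obtain k where "Z k \<inter> snd -` (- side e d) \<notin> H" using opp[OF ed] by blast
    then have "\<forall>\<^sub>\<infinity>n. finite ((Z k \<inter> snd -` (- side e d)) `` {n})" unfolding H_def by simp
    then obtain M where M: "\<And>n. n \<ge> M \<Longrightarrow> finite ((Z k \<inter> snd -` (- side e d)) `` {n})"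
      unfolding MOST_nat_le by blast
    have "finite (c j - side e d)" if "max k M \<le> j" for j
    proof (rule finite_subset)
      show "c j - side e d \<subseteq> (Z k \<inter> snd -` (- side e d)) `` {i j}"
        using Zle[of k j] that unfolding c_def by auto
      show "finite ((Z k \<inter> snd -` (- side e d)) `` {i j})"
        using that strict_mono_imp_increasing[OF i, of j] by (intro M) simp
    qed
    then show ?thesis unfolding MOST_nat_le by blast
  qed
  have bound: "\<exists>m. \<forall>k\<ge>m. k \<notin> y" if "finite y" for y :: "nat set"
    using that unfolding finite_nat_set_iff_bounded by (metis leD)
  have "\<exists>g. \<forall>e\<in>dom \<sigma>. \<forall>\<^sub>\<infinity>j. \<forall>k\<ge>g j. k \<notin> c j - side e (the (\<sigma> e))"
  proof (rule small_pred_bound)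
    show "small (dom \<sigma>)" using \<sigma>(1) unfolding node_def by blast
    show "\<forall>\<^sub>\<infinity>j. \<exists>m. \<forall>k\<ge>m. k \<notin> c j - side e (the (\<sigma> e))" if "e \<in> dom \<sigma>" for e
      by (rule MOST_mono[OF c\<sigma> bound]) (use that in auto)
  qed
  then obtain g where g: "\<And>e. e \<in> dom \<sigma> \<Longrightarrow> \<forall>\<^sub>\<infinity>j. \<forall>k\<ge>g j. k \<notin> c j - side e (the (\<sigma> e))" by blast
  have cS: "finite (c j \<inter> guide_union s)" if "s \<in> S" for j s
    by (rule finite_subset[OF _ xS[OF that, of "i j"]]) (use cx in blast)
  have "\<exists>h. \<forall>s\<in>{s\<in>S. \<exists>m. snd s m \<subseteq>\<^sub>m \<sigma>}. \<forall>\<^sub>\<infinity>j. \<forall>k\<ge>h j. k \<notin> c j \<inter> guide_union s"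
    by (rule small_pred_bound[OF guide_system_small[OF r S \<sigma>(1)]], rule MOST_I, rule bound, rule cS) blast
  then obtain h where h: "\<And>s m. s \<in> S \<Longrightarrow> snd s m \<subseteq>\<^sub>m \<sigma> \<Longrightarrow> \<forall>\<^sub>\<infinity>j. \<forall>k\<ge>h j. k \<notin> c j \<inter> guide_union s"
    by blast
  \<comment> \<open>Trimming finite initial parts removes two errors for almost all
    \<open>j\<close>: \<open>g\<close> the points outside the sides of \<sigma>, \<open>h\<close>
    the points in guides having a node below \<sigma>.\<close>
  define p where "p j = c j - {..<max (g j) (h j)}" for j
  define X where "X k = \<Union>(p ` {k..})" for k
  let ?s = "(p, case_nat \<sigma> (\<lambda>j. \<tau> (i j)))"
  have pc: "p j \<subseteq> c j" for j unfolding p_def by blast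
  have pge: "g j \<le> k" "h j \<le> k" if "k \<in> p j" for j k using that unfolding p_def by auto
  have pinf: "infinite (p j)" for j using Zi unfolding p_def c_def by simp
  have X: "antimono X" unfolding X_def by (rule antimonoI) force
  have X\<sigma>: "\<exists>k. finite (X k - side e d)" if ed: "\<sigma> e = Some d" for e d
  proof -
    obtain M where M: "\<And>j k. j \<ge> M \<Longrightarrow> k \<ge> g j \<Longrightarrow> k \<notin> c j - side e d"
      using g[of e] ed unfolding MOST_nat_le by (auto simp: domI)
    have "p j - side e d = {}" if "M \<le> j" for j using M[OF that] pc pge by blast
    then have "X M - side e d = {}" unfolding X_def by blast
    then show ?thesis by (metis finite.emptyI)
  qed
  have XS: "\<exists>k. finite (X k \<inter> guide_union t)" if t: "t \<in> S" for t
  proof (cases "\<exists>m. snd t m \<subseteq>\<^sub>m \<sigma>")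
    case True
    then obtain M where M: "\<And>j k. j \<ge> M \<Longrightarrow> k \<ge> h j \<Longrightarrow> k \<notin> c j \<inter> guide_union t"
      using h[OF t] unfolding MOST_nat_le by blast
    have "p j \<inter> guide_union t = {}" if "M \<le> j" for j using M[OF that] pc pge by blast
    then have "X M \<inter> guide_union t = {}" unfolding X_def by blast
    then show ?thesis by (metis finite.emptyI)
  next
    case False
    then show ?thesis using guide_system_tail_finite[OF r S \<sigma> t _ X X\<sigma>] by blast
  qed
  have tot: "guide_union ?s = \<Union>(range p)" by (simp add: guide_union_def)
  have "guided ?s"
    unfolding guided_def
  proof (intro conjI allI impI)
    fix m e d assume "snd ?s (Suc m) e = Some d"
    then have "finite (x (i m) - side e d)" using x\<tau> by simp
    then show "finite (fst ?s m - side e d)"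
      by (rule finite_subset[rotated]) (use pc cx in fastforce)
  next
    fix e d assume "snd ?s 0 e = Some d"
    then show "\<exists>k. finite (\<Union>(fst ?s ` {k..}) - side e d)" using X\<sigma> unfolding X_def by simp
  qed
  moreover have "infinite (guide_union ?s)"
    unfolding tot by (rule infinite_super[OF _ pinf[of 0]]) blast
  moreover have "node r (snd ?s m)" for m using \<sigma>(1) \<tau>(1) by (cases m) auto
  moreover have "\<not> snd ?s m \<subseteq>\<^sub>m \<nu>" if "\<nu> \<in> nodes S" for m \<nu>
    using \<sigma>(2) \<tau>(2) that by (cases m) auto
  moreover have "finite (guide_union ?s \<inter> guide_union t)" if t: "t \<in> S" for t
  proof -
    obtain k where k: "finite (X k \<inter> guide_union t)" using XS[OF t] by blast
    \<comment> \<open>Outside a tail \<open>X k\<close> only finitely many pieces remain, each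
      almost disjoint from the old sets.\<close>
    have "\<Union>(range p) \<subseteq> X k \<union> (\<Union>j\<in>{..<k}. c j)"
    proof
      fix y assume "y \<in> \<Union>(range p)"
      then obtain j where "y \<in> p j" by blast
      then show "y \<in> X k \<union> (\<Union>j\<in>{..<k}. c j)"
        using pc unfolding X_def by (cases "j < k") auto
    qed
    then have sub: "guide_union ?s \<inter> guide_union t \<subseteq> (X k \<inter> guide_union t) \<union> (\<Union>j\<in>{..<k}. c j \<inter> guide_union t)"
      unfolding tot by blast
    have "finite (\<Union>j\<in>{..<k}. c j \<inter> guide_union t)" using cS[OF t] by blast
    then show ?thesis using k finite_subset[OF sub] by blast
  qed
  moreover have "\<exists>\<^sub>\<infinity>n. infinite (b n \<inter> guide_union ?s)"
  proof -
    have "infinite (b (i j) \<inter> guide_union ?s)" for j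
      unfolding tot by (rule infinite_super[OF _ pinf[of j]]) (use pc cx x(2) in blast)
    then have "range i \<subseteq> {n. infinite (b n \<inter> guide_union ?s)}" by blast
    moreover have "infinite (range i)"
      using strict_mono_imp_inj_on[OF i] by (rule range_inj_infinite)
    ultimately show ?thesis unfolding INFM_iff_infinite using infinite_super by blast
  qed
  ultimately show ?thesis by blast
qed


section \<open>Counting below the continuum\<close>

lemma continuum_eq: "\<cc> = |UNIV :: (nat \<Rightarrow> bool) set|"
  unfolding cexp_def ctwo_def Field_card_of Field_natLeq Func_def by simp

lemma card_nat_less_continuum: "|UNIV :: nat set| <o |UNIV :: (nat \<Rightarrow> bool) set|"
  using ordLess_ctwo_cexp[OF natLeq_Card_order] card_of_nat ordIso_ordLess_trans
  unfolding continuum_eq by blast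

lemma not_continuum_le_UN_countable:
  assumes V: "|V| <o |UNIV :: (nat \<Rightarrow> bool) set|" and C: "\<And>y. y \<in> V \<Longrightarrow> countable (C y)"
    and D: "countable D"
  shows "\<not> |UNIV :: (nat \<Rightarrow> bool) set| \<le>o |D \<union> (\<Union>y\<in>V. C y)|"
proof -
  \<comment> \<open>\<open>V\<close> may be finite; a disjoint copy of the naturals makes the index
    set infinite while keeping it below the continuum, and its indices carry
    \<open>D\<close>.\<close>
  let ?B = "V <+> (UNIV :: nat set)"
  let ?C = "case_sum C (\<lambda>_. D)"
  have "infinite (UNIV :: (nat \<Rightarrow> bool) set)"
    using card_nat_less_continuum by (metis card_of_ordLeq_infinite infinite_UNIV_nat ordLess_imp_ordLeq)
  then have B: "|?B| <o |UNIV :: (nat \<Rightarrow> bool) set|"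
    by (rule card_of_Plus_ordLess_infinite[OF _ V card_nat_less_continuum])
  have nat: "|UNIV :: nat set| \<le>o |?B|" by (rule card_of_Plus2)
  have le: "|X| \<le>o |?B|" if "countable X" for X :: "'b set"
  proof -
    have "|X| \<le>o |UNIV :: nat set|"
      using that card_of_ordLeq[of X "UNIV :: nat set"] unfolding countable_def by blast
    then show ?thesis using nat by (rule ordLeq_transitive)
  qed
  have "|\<Union>i\<in>?B. ?C i| \<le>o |?B|"
  proof (rule card_of_UNION_ordLeq_infinite)
    show "infinite ?B" by simp
    show "|?B| \<le>o |?B|" by (rule ordIso_imp_ordLeq[OF card_of_refl])
    show "\<forall>i\<in>?B. |?C i| \<le>o |?B|" using C D by (auto intro!: le)
  qed
  moreover have "|D \<union> (\<Union>y\<in>V. C y)| \<le>o |\<Union>i\<in>?B. ?C i|"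
    by (rule card_of_mono1) force
  ultimately have "|D \<union> (\<Union>y\<in>V. C y)| <o |UNIV :: (nat \<Rightarrow> bool) set|"
    using B ordLeq_transitive ordLeq_ordLess_trans by blast
  then show ?thesis using not_ordLess_ordLeq by blast
qed

section \<open>The transfinite recursion\<close>

text \<open>
  The construction starts from the columns of \<open>\<omega> \<times> \<omega>\<close>: an infinite almost disjoint family never
  generates the improper ideal, so \<open>UNIV\<close> stays positive at every stage. The empty node imposes no
  condition.
\<close>

definition column_guide :: "nat \<Rightarrow> guide" where
  "column_guide n = (\<lambda>_. range (\<lambda>k. prod_encode (n, k)), \<lambda>_. Map.empty)"

lemma snd_column_guide [simp]: "snd (column_guide n) m = Map.empty"
  by (simp add: column_guide_def)

lemma guide_union_column_guide: "guide_union (column_guide n) = range (\<lambda>k. prod_encode (n, k))"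
  by (simp add: column_guide_def guide_union_def)

lemma guided_column_guide: "guided (column_guide n)"
  by (simp add: guided_def column_guide_def)

lemma infinite_guide_union_column_guide: "infinite (guide_union (column_guide n))"
  unfolding guide_union_column_guide by (rule range_inj_infinite) (simp add: inj_def prod_encode_eq)

lemma guide_union_column_guide_disjoint:
  "m \<noteq> n \<Longrightarrow> guide_union (column_guide m) \<inter> guide_union (column_guide n) = {}"
  unfolding guide_union_column_guide by (auto simp: prod_encode_eq)

definition earlier :: "((nat \<Rightarrow> bool) \<Rightarrow> guide) \<Rightarrow> (nat \<Rightarrow> bool) set \<Rightarrow> guide set" where
  "earlier f V = range column_guide \<union> f ` V"

text \<open>Stages are points of Cantor space, and stage \<open>x\<close> treats the sequence coded
  by \<open>x\<close>. By surjectivity every sequence of sets gets a stage.\<close>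

definition decode :: "(nat \<Rightarrow> bool) \<Rightarrow> nat \<Rightarrow> nat set" where
  "decode x n = {k. x (prod_encode (n, k))}"

lemma surj_decode: "surj decode"
proof (rule surjI)
  show "decode (\<lambda>j. snd (prod_decode j) \<in> b (fst (prod_decode j))) = b" for b
    by (simp add: decode_def fun_eq_iff)
qed

definition next_guide :: "nat set rel \<Rightarrow> guide set \<Rightarrow> (nat \<Rightarrow> bool) \<Rightarrow> guide \<Rightarrow> bool" where
  "next_guide r S x s \<longleftrightarrow>
     guided s \<and> infinite (guide_union s) \<and> (\<forall>m. node r (snd s m)) \<and>
     (\<forall>m. \<forall>\<nu>\<in>nodes S. \<not> snd s m \<subseteq>\<^sub>m \<nu>) \<and> (\<forall>t\<in>S. finite (guide_union s \<inter> guide_union t)) \<and>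
     ((\<forall>n. decode x n \<in> ideal_positive (guide_union ` S)) \<longrightarrow> (\<exists>\<^sub>\<infinity>n. infinite (decode x n \<inter> guide_union s)))"

text \<open>Almost disjointness of two guides is ensured at the later of their stages. A node used
  at one stage cannot recur at a later one, because it extends itself; so apart from the countably
  many columns each node belongs to at most one stage.\<close>

lemma guide_system_earlier:
  assumes w: "Well_order w" "Field w = UNIV"
    and f: "\<And>y. y \<in> V \<Longrightarrow> next_guide r (earlier f (underS w y)) y (f y)"
  shows "guide_system r (earlier f V)"
proof -
  have lin: "y \<in> underS w z \<or> z \<in> underS w y" if "y \<noteq> z" for y z
    using w that unfolding well_order_on_def linear_order_on_def total_on_def underS_def by blast
  have mem: "f y \<in> earlier f (underS w z)" if "y \<in> underS w z" for y z
    using that unfolding earlier_def by blast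
  have col: "column_guide n \<in> earlier f Y" for n Y unfolding earlier_def by blast
  have fc: "finite (guide_union (f y) \<inter> guide_union (column_guide n))" if "y \<in> V" for y n
    using f[OF that] col unfolding next_guide_def by blast
  have ff: "finite (guide_union (f y) \<inter> guide_union (f z))" if "y \<in> V" "z \<in> V" "f y \<noteq> f z" for y z
  proof -
    have "y \<noteq> z" using that(3) by blast
    then show ?thesis
      using lin f[OF that(1)] f[OF that(2)] mem unfolding next_guide_def by (metis Int_commute)
  qed
  have cc: "finite (guide_union (column_guide m) \<inter> guide_union (column_guide n))"
    if "column_guide m \<noteq> column_guide n" for m n
  proof -
    have "m \<noteq> n" using that by blast
    then show ?thesis using guide_union_column_guide_disjoint by simp
  qed
  have "pairwise (\<lambda>s t. finite (guide_union s \<inter> guide_union t)) (earlier f V)"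
  proof (rule pairwiseI)
    fix s t assume "s \<in> earlier f V" "t \<in> earlier f V" "s \<noteq> t"
    then show "finite (guide_union s \<inter> guide_union t)"
      unfolding earlier_def using fc ff cc by (auto simp: Int_commute)
  qed
  moreover have "countable {s\<in>earlier f V. \<rho> \<in> range (snd s)}" for \<rho>
  proof -
    let ?Y = "{y\<in>V. \<rho> \<in> range (snd (f y))}"
    have no: False if "y \<in> V" "z \<in> V" "\<rho> \<in> range (snd (f y))" "\<rho> \<in> range (snd (f z))"
      "y \<in> underS w z" for y z
    proof -
      have "\<rho> \<in> nodes (earlier f (underS w z))" using mem[OF that(5)] that(3) unfolding nodes_def by blast
      then have "\<not> \<rho> \<subseteq>\<^sub>m \<rho>" using f[OF that(2)] that(4) unfolding next_guide_def by blast
      then show False by simp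
    qed
    have at_most_one: "?Y \<subseteq> {y}" if "y \<in> ?Y" for y using no lin that by blast
    have "countable ?Y"
    proof (cases "\<exists>y. y \<in> ?Y")
      case True
      then obtain y where "y \<in> ?Y" by blast
      from at_most_one[OF this] show ?thesis by (rule countable_subset) simp
    next
      case False
      then have "?Y = {}" by blast
      then show ?thesis by (simp only: countable_empty)
    qed
    then have "countable (range column_guide \<union> f ` ?Y)" by (intro countable_Un countable_image) simp_all
    then show ?thesis by (rule countable_subset[rotated]) (auto simp: earlier_def)
  qed
  moreover have "guided s \<and> infinite (guide_union s) \<and> (\<forall>m. node r (snd s m))"
    if s: "s \<in> earlier f V" for s
  proof -
    consider n where "s = column_guide n" | y where "y \<in> V" "s = f y"
      using s unfolding earlier_def by blast
    then show ?thesis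
    proof cases
      case 1
      then show ?thesis using guided_column_guide infinite_guide_union_column_guide
        by (simp add: node_def countable_imp_small)
    next
      case 2
      then show ?thesis using f unfolding next_guide_def by blast
    qed
  qed
  ultimately show ?thesis unfolding guide_system_def by blast
qed

lemma UNIV_ideal_positive:
  assumes "guide_system r (earlier f V)"
  shows "UNIV \<in> ideal_positive (guide_union ` earlier f V)"
proof (rule ideal_positive_if_meets_infinitely_many)
  show "almost_disjoint (guide_union ` earlier f V)" using assms by (rule guide_system_almost_disjoint)
  have "inj (\<lambda>n. guide_union (column_guide n))"
    using guide_union_column_guide_disjoint infinite_guide_union_column_guide
    by (intro injI) (metis finite.emptyI inf.idem)
  then have "infinite (range (\<lambda>n. guide_union (column_guide n)))" by (rule range_inj_infinite)
  then show "infinite {a \<in> guide_union ` earlier f V. infinite (UNIV \<inter> a)}"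
    by (rule infinite_super[rotated])
      (use infinite_guide_union_column_guide in \<open>auto simp: earlier_def\<close>)
qed

lemma ideal_positive_antimono: "A \<subseteq> B \<Longrightarrow> ideal_positive B \<subseteq> ideal_positive A"
  by (auto simp: mem_ideal_positive_iff)

theorem weakly_tight_of_splitting_le_bounding:
  assumes le: "\<ss>\<^bsub>\<omega>,\<omega>\<^esub> \<le>o \<bb>"
  shows "\<exists>A. weakly_tight A \<and> |A| =o \<cc>"
proof -
  obtain E where E: "omega_omega_splitting E" "\<ss>\<^bsub>\<omega>,\<omega>\<^esub> = |E|"
    using min_card_attained[of "{E. omega_omega_splitting E}"] omega_omega_splitting_Collect_infinite
    unfolding s_omega_omega_def by blast
  let ?r = "|E|" and ?w = "|UNIV :: (nat \<Rightarrow> bool) set|"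
  have r: "Well_order ?r" and F: "Field ?r = E" by (rule card_of_Well_order, rule Field_card_of)
  have w: "Well_order ?w" "Field ?w = UNIV" by (rule card_of_Well_order, rule Field_card_of)
  have under: "small (underS ?r e)" if "e \<in> Field ?r" for e
  proof (rule small_if_less_bounding_number)
    \<comment> \<open>The well-order is a cardinal order, so its proper initial segments are smaller
      than \<open>E\<close>, hence smaller than \<bb>.\<close>
    have "|underS ?r e| <o ?r" using that by (intro card_of_underS card_of_Card_order)
    then show "|underS ?r e| <o \<bb>" using le E(2) ordLess_ordLeq_trans by metis
  qed
  have Fsplit: "omega_omega_splitting (Field ?r)" using E(1) F by simp
  have "\<exists>f. \<forall>x. next_guide ?r (earlier f (underS ?w x)) x (f x)"
  proof (rule dependent_wf_choice[of "?w - Id" "\<lambda>f x s. next_guide ?r (earlier f (underS ?w x)) x s"])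
    show "wf (?w - Id)" using w(1) unfolding well_order_on_def by blast
  next
    fix f g :: "(nat \<Rightarrow> bool) \<Rightarrow> guide" and x s
    assume "\<And>z. (z, x) \<in> ?w - Id \<Longrightarrow> f z = g z"
    then have "f ` underS ?w x = g ` underS ?w x" unfolding underS_def by (intro image_cong) auto
    then show "next_guide ?r (earlier f (underS ?w x)) x s = next_guide ?r (earlier g (underS ?w x)) x s"
      unfolding earlier_def by simp
  next
    fix x :: "nat \<Rightarrow> bool" and f :: "(nat \<Rightarrow> bool) \<Rightarrow> guide"
    assume IH: "\<And>y. (y, x) \<in> ?w - Id \<Longrightarrow> next_guide ?r (earlier f (underS ?w y)) y (f y)"
    let ?S = "earlier f (underS ?w x)"
    have S: "guide_system ?r ?S"
      by (rule guide_system_earlier[OF w]) (use IH in \<open>auto simp: underS_def\<close>)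
    have "|underS ?w x| <o ?w" using w(2) by (intro card_of_underS card_of_Card_order) simp
    \<comment> \<open>Fewer than continuum many stages precede \<open>x\<close>, each using
      countably many nodes; the columns contribute only the empty node.\<close>
    then have "\<not> ?w \<le>o |{Map.empty} \<union> (\<Union>y\<in>underS ?w x. range (snd (f y)))|"
      by (rule not_continuum_le_UN_countable) simp_all
    moreover have "nodes ?S = {Map.empty} \<union> (\<Union>y\<in>underS ?w x. range (snd (f y)))"
      unfolding nodes_def earlier_def by (auto simp: image_iff)
    ultimately have N: "\<not> ?w \<le>o |nodes ?S|" by simp
    \<comment> \<open>If \<open>x\<close> codes a sequence that is not positive, the stage still has to produce a new set.\<close>
    define b where "b = (if \<forall>n. decode x n \<in> ideal_positive (guide_union ` ?S) then decode x else (\<lambda>_. UNIV))"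
    have "b n \<in> ideal_positive (guide_union ` ?S)" for n
      using UNIV_ideal_positive[OF S] unfolding b_def by auto
    then obtain s where "guided s \<and> infinite (guide_union s) \<and> (\<forall>m. node ?r (snd s m)) \<and>
        (\<forall>m. \<forall>\<nu>\<in>nodes ?S. \<not> snd s m \<subseteq>\<^sub>m \<nu>) \<and> (\<forall>t\<in>?S. finite (guide_union s \<inter> guide_union t))"
      and "\<exists>\<^sub>\<infinity>n. infinite (b n \<inter> guide_union s)"
      using new_guide[OF r under Fsplit S N, of b] by blast
    moreover have "b = decode x" if "\<forall>n. decode x n \<in> ideal_positive (guide_union ` ?S)"
      unfolding b_def using that by simp
    ultimately have "next_guide ?r ?S x s" unfolding next_guide_def by blast
    then show "\<exists>s. next_guide ?r ?S x s" by blast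
  qed
  then obtain f where f: "\<And>x. next_guide ?r (earlier f (underS ?w x)) x (f x)" by blast
  let ?A = "guide_union ` earlier f UNIV"
  have S: "guide_system ?r (earlier f UNIV)" by (rule guide_system_earlier[OF w f])
  have "weakly_tight ?A"
    unfolding weakly_tight_def
  proof (intro conjI allI impI)
    show "almost_disjoint ?A" by (rule guide_system_almost_disjoint[OF S])
    fix b :: "nat \<Rightarrow> nat set" assume b: "range b \<subseteq> ideal_positive ?A"
    obtain x where x: "b = decode x" using surjD[OF surj_decode] by blast
    \<comment> \<open>Enlarging a family shrinks its positive sets, so a sequence positive for the
      final family was already positive at its own stage.\<close>
    have "guide_union ` earlier f (underS ?w x) \<subseteq> ?A" unfolding earlier_def by blast
    then have "\<forall>n. decode x n \<in> ideal_positive (guide_union ` earlier f (underS ?w x))"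
      using b ideal_positive_antimono unfolding x by blast
    then have "\<exists>\<^sub>\<infinity>n. infinite (b n \<inter> guide_union (f x))" using f[of x] unfolding next_guide_def x by blast
    then show "\<exists>a\<in>?A. \<exists>\<^sub>\<infinity>n. infinite (b n \<inter> a)" unfolding earlier_def by blast
  qed
  moreover have "|?A| =o \<cc>"
    unfolding continuum_eq ordIso_iff_ordLeq
  proof
    have "inj_on (\<lambda>a n. n \<in> a) ?A" by (auto simp: inj_on_def fun_eq_iff)
    then show "|?A| \<le>o ?w" using card_of_ordLeq[of ?A UNIV] by blast
    \<comment> \<open>The later of two sets is infinite and meets the earlier one in a finite set,
      so different stages give different sets.\<close>
    have "guide_union (f x) \<noteq> guide_union (f y)" if "x \<in> underS ?w y" for x y
    proof -
      have "infinite (guide_union (f y))" "finite (guide_union (f y) \<inter> guide_union (f x))"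
        using f[of y] that unfolding next_guide_def earlier_def by blast+
      then show ?thesis by auto
    qed
    moreover have "x \<in> underS ?w y \<or> y \<in> underS ?w x" if "x \<noteq> y" for x y
      using w that unfolding well_order_on_def linear_order_on_def total_on_def underS_def by blast
    ultimately have "inj (\<lambda>x. guide_union (f x))" unfolding inj_def by metis
    moreover have "range (\<lambda>x. guide_union (f x)) \<subseteq> ?A" unfolding earlier_def by blast
    ultimately show "?w \<le>o |?A|" using card_of_ordLeq[of UNIV ?A] by blast
  qed
  ultimately show ?thesis by blast
qed

section \<open>Comparisons of cardinal invariants\<close>

text \<open>Iterating \<open>f\<close> cuts the naturals into consecutive intervals, nonempty thanks
  to the maximum with \<open>Suc k\<close>. Every \<open>b n\<close> meets almost all of them, hence
  infinitely many of even and infinitely many of odd index.\<close>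

lemma interval_splitting:
  fixes f :: "nat \<Rightarrow> nat"
  defines "i \<equiv> \<lambda>j. ((\<lambda>k. max (f k) (Suc k)) ^^ j) 0"
  assumes b: "\<And>n. infinite (b n)" and f: "\<forall>\<^sub>\<infinity>k. \<forall>n\<le>k. \<exists>m\<in>b n. k \<le> m \<and> m < f k"
  shows "infinite (b n \<inter> (\<Union>j. {i (2 * j)..<i (2 * j + 1)}))"
    and "infinite (b n \<inter> - (\<Union>j. {i (2 * j)..<i (2 * j + 1)}))"
proof -
  have iS: "i (Suc j) = max (f (i j)) (Suc (i j))" for j by (simp add: i_def)
  then have mono: "strict_mono i" unfolding strict_mono_Suc_iff by (simp add: less_max_iff_disj)
  obtain K where K: "\<And>k n. K \<le> k \<Longrightarrow> n \<le> k \<Longrightarrow> \<exists>m\<in>b n. k \<le> m \<and> m < f k"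
    using f unfolding MOST_nat_le by blast
  have ex: "\<exists>m\<in>b n. i j \<le> m \<and> m < i (Suc j)" if "max K n \<le> j" for j
  proof -
    have "K \<le> i j" "n \<le> i j" using that strict_mono_imp_increasing[OF mono, of j] by auto
    then show ?thesis using K[of "i j" n] iS[of j] by (auto simp: less_max_iff_disj)
  qed
  \<comment> \<open>Here \<open>c\<close> is the parity of the intervals contained in
    \<open>X\<close>.\<close>
  have inf: "infinite (b n \<inter> X)" if "\<And>j. {i (2 * j + c)..<i (2 * j + c + 1)} \<subseteq> X" for c X
    unfolding infinite_nat_iff_unbounded_le
  proof
    fix M
    let ?j = "2 * (K + n + M) + c"
    obtain m where m: "m \<in> b n" "i ?j \<le> m" "m < i (Suc ?j)" using ex[of ?j] by auto
    have "M \<le> ?j" by simp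
    also have "?j \<le> i ?j" by (rule strict_mono_imp_increasing[OF mono])
    finally have "M \<le> m" using m(2) by (rule order_trans)
    moreover have "m \<in> X" using that[of "K + n + M"] m(2,3) by auto
    ultimately show "\<exists>m\<ge>M. m \<in> b n \<inter> X" using m(1) by blast
  qed
  show "infinite (b n \<inter> (\<Union>j. {i (2 * j)..<i (2 * j + 1)}))"
    by (rule inf[of 0]) auto
  have disj: False if "i (2 * j + 1) \<le> m" "m < i (2 * j + 2)" "i (2 * l) \<le> m" "m < i (2 * l + 1)" for j l m
  proof -
    have "i (2 * j + 1) < i (2 * l + 1)" "i (2 * l) < i (2 * j + 2)" using that by linarith+
    then have "2 * j + 1 < 2 * l + 1" "2 * l < 2 * j + 2"
      using strict_mono_less[OF mono] by blast+
    then show False by presburger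
  qed
  show "infinite (b n \<inter> - (\<Union>j. {i (2 * j)..<i (2 * j + 1)}))"
    by (rule inf[of 1]) (use disj in \<open>auto simp: numeral_2_eq_2\<close>)
qed

lemma s_omega_omega_le_dominating_number: "\<ss>\<^bsub>\<omega>,\<omega>\<^esub> \<le>o \<dd>"
proof -
  obtain D where D: "dominating_family D" "\<dd> = |D|"
    using min_card_attained[of "{F. dominating_family F}"] dominating_family_UNIV
    unfolding dominating_number_def by blast
  define i where "i f = (\<lambda>j. ((\<lambda>k. max (f k) (Suc k)) ^^ j) 0)" for f :: "nat \<Rightarrow> nat"
  define e where "e f = (\<Union>j. {i f (2 * j)..<i f (2 * j + 1)})" for f
  have split: "\<exists>f\<in>D. \<forall>n. infinite (b n \<inter> e f) \<and> infinite (b n \<inter> - e f)"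
    if b: "\<And>n. infinite (b n)" for b :: "nat \<Rightarrow> nat set"
  proof -
    have "\<exists>m. m \<in> b n \<and> k \<le> m" for n k
      using b[of n] unfolding infinite_nat_iff_unbounded_le by blast
    then obtain u where u: "\<And>n k. u n k \<in> b n" "\<And>n k. k \<le> u n k" by metis
    \<comment> \<open>\<open>g k\<close> exceeds some element above \<open>k\<close> of each of the
      first \<open>k + 1\<close> sets, so a single dominating \<open>f\<close> serves all
      \<open>b n\<close> together.\<close>
    define g where "g k = Suc (\<Sum>n\<le>k. u n k)" for k
    have g: "u n k < g k" if "n \<le> k" for n k
      unfolding g_def less_Suc_eq_le by (rule member_le_sum) (use that in auto)
    obtain f where f: "f \<in> D" "g \<le>* f" using D(1) unfolding dominating_family_def by blast
    from f(2) have "\<forall>\<^sub>\<infinity>k. \<forall>n\<le>k. \<exists>m\<in>b n. k \<le> m \<and> m < f k"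
      unfolding eventually_dominated_def
      by (rule MOST_mono) (meson g u order_less_le_trans)
    from interval_splitting[OF b this] show ?thesis
      using f(1) unfolding e_def i_def by blast
  qed
  \<comment> \<open>Members of a splitting family must be infinite; intersecting with the infinite
    sets secures this and keeps every witness.\<close>
  have "omega_omega_splitting (e ` D \<inter> {x. infinite x})"
    unfolding omega_omega_splitting_def
  proof (intro conjI ballI allI impI)
    fix b :: "nat \<Rightarrow> nat set" assume "\<forall>n. infinite (b n)"
    then obtain f where f: "f \<in> D" "\<And>n. infinite (b n \<inter> e f)" "\<And>n. infinite (b n \<inter> - e f)"
      using split[of b] by blast
    have "infinite (e f)" using f(2)[of 0] by blast
    then show "\<exists>e\<in>e ` D \<inter> {x. infinite x}. (\<exists>\<^sub>\<infinity>n. infinite (b n \<inter> e)) \<and> (\<exists>\<^sub>\<infinity>n. infinite (b n \<inter> - e))"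
      using f by (intro bexI[of _ "e f"]) auto
  qed simp
  then have "\<ss>\<^bsub>\<omega>,\<omega>\<^esub> \<le>o |e ` D \<inter> {x. infinite x}|"
    unfolding s_omega_omega_def using min_card_le[of "{E. omega_omega_splitting E}"] by blast
  also have "|e ` D \<inter> {x. infinite x}| \<le>o |e ` D|" by (rule card_of_mono1) blast
  also have "|e ` D| \<le>o |D|" by (rule card_of_image)
  finally show ?thesis unfolding D(2) .
qed

text \<open>Countable sets are small, so an unbounded family is uncountable.\<close>

lemma omega_1_le_bounding_number: "\<omega>\<^sub>1 \<le>o \<bb>"
proof -
  obtain F where F: "unbounded_family F" "\<bb> = |F|" using bounding_number_attained by blast
  have "\<not> countable F"
  proof
    assume "countable F"
    from smallD[OF countable_imp_small[OF this], of "\<lambda>f. f"] show False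
      using F(1) unfolding unbounded_family_def by blast
  qed
  then have "\<not> |F| \<le>o |UNIV :: nat set|"
    unfolding countable_def card_of_ordLeq[symmetric] by blast
  then have "|UNIV :: nat set| <o |F|"
    unfolding not_ordLeq_iff_ordLess[OF card_of_Well_order card_of_Well_order] .
  then have "natLeq <o |F|" using card_of_nat ordIso_ordLess_trans ordIso_symmetric by blast
  then show ?thesis unfolding F(2) by (rule cardSuc_least[OF natLeq_Card_order card_of_Card_order])
qed

theorem theorem5:
  shows "(\<ss>\<^bsub>\<omega>,\<omega>\<^esub> \<le>o \<bb> \<longrightarrow> (\<exists>A :: nat set set. weakly_tight A \<and> |A| =o \<cc>)) \<and>
         (\<bb> =o \<dd> \<longrightarrow> (\<exists>A :: nat set set. weakly_tight A \<and> |A| =o \<cc>)) \<and>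
         (\<ss>\<^bsub>\<omega>,\<omega>\<^esub> =o \<omega>\<^sub>1 \<longrightarrow> (\<exists>A :: nat set set. weakly_tight A \<and> |A| =o \<cc>))"
proof (intro conjI impI)
  show "\<exists>A. weakly_tight A \<and> |A| =o \<cc>" if "\<ss>\<^bsub>\<omega>,\<omega>\<^esub> \<le>o \<bb>"
    using that by (rule weakly_tight_of_splitting_le_bounding)
  show "\<exists>A. weakly_tight A \<and> |A| =o \<cc>" if "\<bb> =o \<dd>"
    using s_omega_omega_le_dominating_number that
    by (intro weakly_tight_of_splitting_le_bounding) (metis ordIso_symmetric ordLeq_ordIso_trans)
  show "\<exists>A. weakly_tight A \<and> |A| =o \<cc>" if "\<ss>\<^bsub>\<omega>,\<omega>\<^esub> =o \<omega>\<^sub>1"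
    using that omega_1_le_bounding_number
    by (intro weakly_tight_of_splitting_le_bounding) (rule ordIso_ordLeq_trans)
qed


end
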